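(* The map $\phi:\mathbb R_{m|2n}^{(2)E}(\Lambda_N)\to\mathfrak{so}_0$ defined by $$\phi(B)\,\mathbf x=[B,\mathbf x]=B\mathbf x-\mathbf xB,\qquad B\in\mathbb R_{m|2n}^{(2)E}(\Lambda_N),\ \mathbf x\in\mathbf S,$$ is a Lie algebra isomorphism.
   Context: Let $m,n,N\in\mathbb N=\{1,2,\dots\}$. $\Lambda_N$ is the real Grassmann algebra generated by anticommuting $f_1,\dots,f_N$, with basis $f_A$, $A\subset\{1,\dots,N\}$; $\Lambda_N^{(ev)}$ and $\Lambda_N^{(odd)}$ are the spans of the $f_A$ with $|A|$ even, resp. odd. $\mathcal C_{m,2n}$ is the real unital associative algebra generated by $e_1,\dots,e_m,e'_1,\dots,e'_{2n}$ with relations $e_je_k+e_ke_j=-2\delta_{j,k}$, $e_je'_k+e'_ke_j=0$, $e'_je'_k-e'_ke'_j=g_{j,k}$, where $g_{2j,2k}=g_{2j-1,2k-1}=0$, $g_{2j-1,2k}=-g_{2k,2j-1}=\delta_{j,k}$ ($1\le j,k\le n$). $\mathbf S$ is a finite set of more than one independent supervector variables $\mathbf x=\sum_{j=1}^m x_je_j+\sum_{j=1}^{2n}x'_je'_j$, each with its own $m$ commuting variables $x_j$ and $2n$ anticommuting variables $x'_j$; $\mathcal V$ is the free supercommutative real polynomial algebra in all these variables. In $\mathcal A_{m,2n}\otimes\Lambda_N=\mathcal V\otimes\Lambda_N\otimes\mathcal C_{m,2n}$ the $x'_j$ and $f_k$ anticommute with each other, the $x_j$ commute with everything in $\mathcal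 V\otimes\Lambda_N$, and elements of $\mathcal V\otimes\Lambda_N$ commute with $\mathcal C_{m,2n}$. $\mathbb R_{m|2n}^{(2)E}(\Lambda_N)$ (extended superbivectors) is the real space of elements $$B=\sum_{1\le j<k\le m}b_{j,k}e_je_k+\sum_{1\le j\le m,\,1\le k\le2n}b'_{j,k}e_je'_k+\sum_{1\le j\le k\le2n}B_{j,k}\,e'_j\odot e'_k,\quad b_{j,k},B_{j,k}\in\Lambda_N^{(ev)},\ b'_{j,k}\in\Lambda_N^{(odd)},$$ with $e'_j\odot e'_k=\frac12(e'_je'_k+e'_ke'_j)$. It is a Lie algebra under the commutator. $\mathrm{Mat}(m|2n)(\Lambda_N)$ is the algebra of supermatrices $M=\begin{pmatrix}A&B'\\C'&D\end{pmatrix}$ with $A,D$ ($m\times m$, $2n\times2n$) having entries in $\Lambda_N^{(ev)}$ and $B',C'$ ($m\times2n$, $2n\times m$) having entries in $\Lambda_N^{(odd)}$; $M^{ST}=\begin{pmatrix}A^T&C'^T\\-B'^T&D^T\end{pmatrix}$. A supermatrix acts on a supervector variable by left multiplication of its coordinate column $(x_1,\dots,x_m,x'_1,\dots,x'_{2n})^T$, the result being read as coefficients of $e_1,\dots,e_m,e'_1,\dots,e'_{2n}$. $\phi(B)$ denotes the supermatrix representing $\mathbf x\mapsto[B,\mathbf x]$. $\Omega_{2n}$ is block diagonal with $n$ blocks $\begin{pmatrix}0&1\\-1&0\end{pmatrix}$, $\mathbf Q=\begin{pmatrix}I_m&0\\0&-\frac12\Omega_{2n}\end{pmatrix}$, and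 $\mathfrak{so}_0=\{X\in\mathrm{Mat}(m|2n)(\Lambda_N):X^{ST}\mathbf Q+\mathbf QX=0\}$, a Lie algebra under the commutator. *)

theory Defs
  imports "HOL-Analysis.Analysis"
begin

section \<open>The algebra of supervector variables, Grassmann numbers and Clifford--Weyl generators\<close>

text \<open>
  The dimensions are types: the index sets \<open>{1..m}\<close>, \<open>{1..n}\<close>, \<open>{1..N}\<close> are arbitrary
  finite linearly ordered types \<open>'m\<close>, \<open>'n\<close>, \<open>'l\<close>; the type \<open>'s\<close> labels the supervector
  variables. The index set \<open>{1..2n}\<close> is \<open>'n \<times> bool\<close>, where \<open>(j, False)\<close> stands for \<open>2j-1\<close>
  and \<open>(j, True)\<close> stands for \<open>2j\<close>.
\<close>

datatype ('s, 'm, 'n, 'l) gen =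
    Bos 's 'm             \<comment> \<open>commuting variable \<open>x\<^sub>j\<close> of the supervector variable \<open>s\<close>\<close>
  | Fer 's "'n \<times> bool"    \<comment> \<open>anticommuting variable \<open>x'\<^sub>j\<close> of the supervector variable \<open>s\<close>\<close>
  | Gra 'l                \<comment> \<open>\<open>f\<^sub>k\<close>\<close>
  | Cli 'm                \<comment> \<open>\<open>e\<^sub>j\<close>\<close>
  | Wey "'n \<times> bool"       \<comment> \<open>\<open>e'\<^sub>j\<close>\<close>

datatype 'g alg_term =
    Gen 'g
  | Const real
  | Add "'g alg_term" "'g alg_term"
  | Mul "'g alg_term" "'g alg_term"

text \<open>
  The least congruence that contains the relations \<open>R\<close> and the axioms of real unital
  associative algebras; its quotient is the algebra presented by the generators \<open>'g\<close>
  and the relations \<open>R\<close>.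
\<close>

inductive alg_eq :: "('g alg_term \<Rightarrow> 'g alg_term \<Rightarrow> bool) \<Rightarrow> 'g alg_term \<Rightarrow> 'g alg_term \<Rightarrow> bool"
  for R where
  rel: "R a b \<Longrightarrow> alg_eq R a b"
| refl: "alg_eq R a a"
| sym: "alg_eq R a b \<Longrightarrow> alg_eq R b a"
| trans: "alg_eq R a b \<Longrightarrow> alg_eq R b c \<Longrightarrow> alg_eq R a c"
| add_cong: "alg_eq R a b \<Longrightarrow> alg_eq R c d \<Longrightarrow> alg_eq R (Add a c) (Add b d)"
| mul_cong: "alg_eq R a b \<Longrightarrow> alg_eq R c d \<Longrightarrow> alg_eq R (Mul a c) (Mul b d)"
| add_assoc: "alg_eq R (Add (Add a b) c) (Add a (Add b c))"
| add_comm: "alg_eq R (Add a b) (Add b a)"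
| add_zero: "alg_eq R (Add (Const 0) a) a"
| add_neg: "alg_eq R (Add (Mul (Const (-1)) a) a) (Const 0)"
| mul_assoc: "alg_eq R (Mul (Mul a b) c) (Mul a (Mul b c))"
| mul_one: "alg_eq R (Mul (Const 1) a) a"
| distrib_left: "alg_eq R (Mul a (Add b c)) (Add (Mul a b) (Mul a c))"
| distrib_right: "alg_eq R (Mul (Add a b) c) (Add (Mul a c) (Mul b c))"
| const_add: "alg_eq R (Add (Const r) (Const s)) (Const (r + s))"
| const_mul: "alg_eq R (Mul (Const r) (Const s)) (Const (r * s))"
| const_comm: "alg_eq R (Mul (Const r) a) (Mul a (Const r))"

fun g_form :: "'n \<times> bool \<Rightarrow> 'n \<times> bool \<Rightarrow> real" where
  "g_form (j, a) (k, b) =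
     (if j = k then (if \<not> a \<and> b then 1 else if a \<and> \<not> b then -1 else 0) else 0)"

abbreviation (input) commute_rel where
  "commute_rel u v \<equiv> \<lambda>a b. a = Mul (Gen u) (Gen v) \<and> b = Mul (Gen v) (Gen u)"

abbreviation (input) anticommute_rel where
  "anticommute_rel u v \<equiv>
     \<lambda>a b. a = Add (Mul (Gen u) (Gen v)) (Mul (Gen v) (Gen u)) \<and> b = Const 0"

text \<open>
  The relations of \<open>\<V> \<otimes> \<Lambda>\<^sub>N \<otimes> \<C>\<^bsub>m,2n\<^esub>\<close>. The anticommutation relations include
  equal generators, so the squares of the \<open>x'\<^sub>j\<close> and of the \<open>f\<^sub>k\<close> vanish. In \<open>\<V> \<otimes> \<Lambda>\<^sub>N\<close> the
  tensor product is that of superalgebras (\<open>x'\<^sub>j\<close> and \<open>f\<^sub>k\<close> anticommute), whereas the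
  elements of \<open>\<V> \<otimes> \<Lambda>\<^sub>N\<close> commute with all \<open>e\<^sub>j\<close> and \<open>e'\<^sub>j\<close>.
\<close>

definition scalar_gen :: "('s, 'm, 'n, 'l) gen \<Rightarrow> bool" where
  "scalar_gen u \<longleftrightarrow> (\<exists>s j. u = Bos s j) \<or> (\<exists>s j. u = Fer s j) \<or> (\<exists>k. u = Gra k)"

definition odd_scalar_gen :: "('s, 'm, 'n, 'l) gen \<Rightarrow> bool" where
  "odd_scalar_gen u \<longleftrightarrow> (\<exists>s j. u = Fer s j) \<or> (\<exists>k. u = Gra k)"

inductive superalg_rel ::
  "('s, 'm, 'n, 'l) gen alg_term \<Rightarrow> ('s, 'm, 'n, 'l) gen alg_term \<Rightarrow> bool" where
  bos: "scalar_gen v \<Longrightarrow> commute_rel (Bos s j) v a b \<Longrightarrow> superalg_rel a b"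
| fer: "odd_scalar_gen u \<Longrightarrow> odd_scalar_gen v \<Longrightarrow> anticommute_rel u v a b \<Longrightarrow> superalg_rel a b"
| scalar_cli: "scalar_gen u \<Longrightarrow> commute_rel u (Cli j) a b \<Longrightarrow> superalg_rel a b"
| scalar_wey: "scalar_gen u \<Longrightarrow> commute_rel u (Wey j) a b \<Longrightarrow> superalg_rel a b"
| cli: "superalg_rel (Add (Mul (Gen (Cli j)) (Gen (Cli k))) (Mul (Gen (Cli k)) (Gen (Cli j))))
          (Const (if j = k then -2 else 0))"
| cli_wey: "anticommute_rel (Cli j) (Wey k) a b \<Longrightarrow> superalg_rel a b"
| wey: "superalg_rel
          (Add (Mul (Gen (Wey j)) (Gen (Wey k)))
               (Mul (Const (-1)) (Mul (Gen (Wey k)) (Gen (Wey j)))))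
          (Const (g_form j k))"

quotient_type ('s, 'm, 'n, 'l) superalg =
  "('s, 'm, 'n, 'l) gen alg_term" / "alg_eq superalg_rel"
  by (rule equivpI) (auto simp: reflp_def symp_def transp_def intro: alg_eq.refl
        elim: alg_eq.sym alg_eq.trans)

text \<open>
  Terms act on any real vector space on which the generators act linearly; identities of the
  presented algebra hold in every such module in which its relations hold.
\<close>

primrec act :: "('g \<Rightarrow> 'v \<Rightarrow> 'v::real_vector) \<Rightarrow> 'g alg_term \<Rightarrow> 'v \<Rightarrow> 'v" where
  "act h (Gen u) v = h u v"
| "act h (Const r) v = r *\<^sub>R v"
| "act h (Add a b) v = act h a v + act h b v"
| "act h (Mul a b) v = act h a (act h b v)"

lemma linear_act:
  assumes "\<And>u. linear (h u)"
  shows "linear (act h a)"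
proof (induction a)
  case (Gen u)
  have "act h (Gen u) = h u" by (rule ext) simp
  then show ?case using assms by simp
next
  case (Const r)
  show ?case by (auto intro!: linearI simp: algebra_simps)
next
  case (Add a b)
  then show ?case by (auto intro!: linearI simp: linear_add linear_scale algebra_simps)
next
  case (Mul a b)
  then show ?case by (auto intro!: linearI simp: linear_add linear_scale)
qed

lemma act_eq:
  assumes "\<And>u. linear (h u)" and "\<And>a b v. R a b \<Longrightarrow> act h a v = act h b v"
    and "alg_eq R a b"
  shows "act h a v = act h b v"
  using assms(3)
proof (induction arbitrary: v rule: alg_eq.induct)
  case (distrib_left a b c)
  then show ?case by (simp add: linear_add[OF linear_act[OF assms(1)]])
next
  case (const_comm r a)
  then show ?case by (simp add: linear_scale[OF linear_act[OF assms(1)]])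
qed (auto simp: assms(2) scaleR_add_left)

text \<open>
  The algebra is not trivial: the generators \<open>e\<^sub>j\<close> and \<open>e'\<^sub>j\<close> act on the functions of
  \<open>(A, \<alpha>)\<close>, the coefficients of \<open>e\<^sub>A y\<^sup>\<alpha>\<close>, as Clifford generators and as
  \<open>\<partial>/\<partial>y\<^sub>j\<close> and \<open>y\<^sub>j\<close> (up to the parity of \<open>A\<close>), the other generators act as \<open>0\<close>.
\<close>

typedef ('m, 'n) spinor = "UNIV :: ('m set \<Rightarrow> ('n \<Rightarrow> nat) \<Rightarrow> real) set"
  morphisms spinor_coeff Spinor ..

setup_lifting type_definition_spinor

instantiation spinor :: (type, type) real_vector
begin
lift_definition zero_spinor :: "('a, 'b) spinor" is "\<lambda>A \<alpha>. 0" .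
lift_definition plus_spinor :: "('a, 'b) spinor \<Rightarrow> ('a, 'b) spinor \<Rightarrow> ('a, 'b) spinor"
  is "\<lambda>u v A \<alpha>. u A \<alpha> + v A \<alpha>" .
lift_definition minus_spinor :: "('a, 'b) spinor \<Rightarrow> ('a, 'b) spinor \<Rightarrow> ('a, 'b) spinor"
  is "\<lambda>u v A \<alpha>. u A \<alpha> - v A \<alpha>" .
lift_definition uminus_spinor :: "('a, 'b) spinor \<Rightarrow> ('a, 'b) spinor"
  is "\<lambda>u A \<alpha>. - u A \<alpha>" .
lift_definition scaleR_spinor :: "real \<Rightarrow> ('a, 'b) spinor \<Rightarrow> ('a, 'b) spinor"
  is "\<lambda>r u A \<alpha>. r * u A \<alpha>" .
instance
  by standard (transfer; simp add: fun_eq_iff algebra_simps)+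
end

lift_definition cli_op :: "'m::{finite,linorder} \<Rightarrow> ('m, 'n) spinor \<Rightarrow> ('m, 'n) spinor" is
  "\<lambda>j u A \<alpha>. (\<Prod>i\<in>A. if i < j then -1 else 1) * (if j \<in> A then 1 else -1)
      * u (if j \<in> A then A - {j} else insert j A) \<alpha>" .

lift_definition wey_op :: "'n \<times> bool \<Rightarrow> ('m::{finite,linorder}, 'n) spinor \<Rightarrow> ('m, 'n) spinor" is
  "\<lambda>(j, a) u A \<alpha>. (-1) ^ card A *
      (if a then (if \<alpha> j = 0 then 0 else u A (\<alpha>(j := \<alpha> j - 1)))
       else real (\<alpha> j + 1) * u A (\<alpha>(j := \<alpha> j + 1)))" .

primrec spinor_op ::
  "('s, 'm::{finite,linorder}, 'n, 'l) gen \<Rightarrow> ('m, 'n) spinor \<Rightarrow> ('m, 'n) spinor" where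
  "spinor_op (Bos s j) = (\<lambda>v. 0)"
| "spinor_op (Fer s k) = (\<lambda>v. 0)"
| "spinor_op (Gra l) = (\<lambda>v. 0)"
| "spinor_op (Cli j) = cli_op j"
| "spinor_op (Wey k) = wey_op k"

lemma linear_spinor_op: "linear (spinor_op u)"
proof (cases u)
  case (Cli j)
  have "linear (cli_op j)" by (rule linearI; transfer; simp add: fun_eq_iff algebra_simps)
  then show ?thesis using Cli by simp
next
  case (Wey k)
  have "linear (wey_op k)"
    by (rule linearI; transfer; simp add: fun_eq_iff algebra_simps split: prod.splits)
  then show ?thesis using Wey by simp
qed (auto intro: linearI)

lemma prod_sign_flip:
  fixes A :: "'m::{finite,linorder} set"
  shows "(\<Prod>i\<in>(if k \<in> A then A - {k} else insert k A). if i < j then -1 else 1 :: real) =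
           (if k < j then -1 else 1) * (\<Prod>i\<in>A. if i < j then -1 else 1)"
proof (cases "k \<in> A")
  case True
  then have "(\<Prod>i\<in>A. if i < j then -1 else 1 :: real) =
      (if k < j then -1 else 1) * (\<Prod>i\<in>A - {k}. if i < j then -1 else 1)"
    by (intro prod.remove) auto
  then show ?thesis using True by simp
qed simp

lemma prod_sign_square:
  "(\<Prod>i\<in>A. if i < j then -1 else 1 :: real) * (\<Prod>i\<in>A. if i < j then -1 else 1) = 1"
  unfolding prod.distrib[symmetric] by (rule prod.neutral) auto

lemma cli_op_cli_op:
  fixes j k :: "'m::{finite,linorder}" and v :: "('m, 'n) spinor"
  shows "cli_op j (cli_op k v) + cli_op k (cli_op j v) = (if j = k then -2 else 0) *\<^sub>R v"
proof -
  define tog where "tog i A = (if i \<in> A then A - {i} else insert i A)" for i :: 'm and A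
  define sg where "sg i A = (\<Prod>l\<in>A. if l < i then -1 else 1 :: real)" for i :: 'm and A
  have coeff: "spinor_coeff (cli_op i u) A \<alpha> =
      sg i A * (if i \<in> A then 1 else -1) * spinor_coeff u (tog i A) \<alpha>"
    for i A \<alpha> and u :: "('m, 'n) spinor"
    unfolding tog_def sg_def by (simp add: cli_op.rep_eq)
  have sg_tog: "sg i (tog l A) = (if l < i then -1 else 1) * sg i A" for i l A
    unfolding sg_def tog_def by (rule prod_sign_flip)
  have sq: "sg i A * (sg i A * c) = c" for i A c
    using prod_sign_square[of i A] by (simp add: sg_def flip: mult.assoc)
  have mem: "i \<in> tog l A \<longleftrightarrow> (i \<in> A) \<noteq> (i = l)" for i l A
    by (auto simp: tog_def)
  have tog: "tog k (tog j A) = tog j (tog k A)" "tog l (tog l A) = A" for l A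
    by (auto simp: set_eq_iff mem)
  have "spinor_coeff (cli_op j (cli_op k v)) A \<alpha> + spinor_coeff (cli_op k (cli_op j v)) A \<alpha> =
      (if j = k then -2 else 0) * spinor_coeff v A \<alpha>" for A \<alpha>
    by (cases j k rule: linorder_cases) (auto simp: coeff sg_tog tog mem sq)
  then show ?thesis
    by (intro spinor_coeff_inject[THEN iffD1] ext)
      (simp add: plus_spinor.rep_eq scaleR_spinor.rep_eq)
qed

lemma power_card_flip:
  fixes A :: "'m::finite set"
  shows "(-1 :: real) ^ card (if j \<in> A then A - {j} else insert j A) = - ((-1) ^ card A)"
proof (cases "j \<in> A")
  case True
  have "card A = Suc (card (A - {j}))"
    by (rule card.remove) (use True in auto)
  then show ?thesis using True by (simp del: card_Diff_insert card_Diff_singleton)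
qed simp

lemma cli_op_wey_op: "cli_op j (wey_op k v) + wey_op k (cli_op j v) = 0"
proof -
  have "spinor_coeff (cli_op j (wey_op k v)) A \<alpha> + spinor_coeff (wey_op k (cli_op j v)) A \<alpha> = 0"
    for A \<alpha>
    using power_card_flip[of j A]
    by (cases k) (simp add: cli_op.rep_eq wey_op.rep_eq)
  then show ?thesis
    by (intro spinor_coeff_inject[THEN iffD1] ext)
      (simp add: plus_spinor.rep_eq zero_spinor.rep_eq)
qed

lemma wey_op_wey_op: "wey_op j (wey_op k v) - wey_op k (wey_op j v) = g_form j k *\<^sub>R v"
proof -
  obtain j' a k' b where jk: "j = (j', a)" "k = (k', b)"
    by (metis surj_pair)
  have "spinor_coeff (wey_op j (wey_op k v)) A \<alpha> - spinor_coeff (wey_op k (wey_op j v)) A \<alpha> =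
      g_form j k * spinor_coeff v A \<alpha>" for A \<alpha>
  proof -
    define \<sigma> :: real where "\<sigma> = (-1) ^ card A"
    have sq: "\<sigma> * (c * (\<sigma> * d)) = c * d" "\<sigma> * (\<sigma> * d) = d" for c d
      by (simp_all add: \<sigma>_def minus_one_power_iff)
    have coeff: "spinor_coeff (wey_op (i, c) u) A \<beta> =
        \<sigma> * (if c then (if \<beta> i = 0 then 0 else spinor_coeff u A (\<beta>(i := \<beta> i - 1)))
             else real (\<beta> i + 1) * spinor_coeff u A (\<beta>(i := \<beta> i + 1)))" for i c u \<beta>
      by (simp add: wey_op.rep_eq \<sigma>_def)
    show ?thesis
    proof (cases "j' = k'")
      case True
      then show ?thesis
        by (cases a; cases b)
          (simp_all add: jk coeff sq flip: left_diff_distrib)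
    next
      case False
      have twist: "\<alpha>(j' := x, k' := y) = \<alpha>(k' := y, j' := x)" for x y
        using False by (rule fun_upd_twist)
      show ?thesis
        using False
        by (cases a; cases b)
          (simp_all add: jk coeff twist sq)
    qed
  qed
  then show ?thesis
    by (intro spinor_coeff_inject[THEN iffD1] ext)
      (simp add: minus_spinor.rep_eq scaleR_spinor.rep_eq)
qed

lemma act_spinor_op_rel:
  fixes a b :: "('s, 'm::{finite,linorder}, 'n, 'l) gen alg_term"
  assumes "superalg_rel a b"
  shows "act spinor_op a v = act spinor_op b v"
proof -
  have 0: "spinor_op u 0 = 0" for u :: "('s, 'm, 'n, 'l) gen"
    by (rule linear_0[OF linear_spinor_op])
  have s: "spinor_op u w = 0" if "scalar_gen u" for u :: "('s, 'm, 'n, 'l) gen" and w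
    using that by (auto simp: scalar_gen_def)
  have o: "spinor_op u w = 0" if "odd_scalar_gen u" for u :: "('s, 'm, 'n, 'l) gen" and w
    using that by (auto simp: odd_scalar_gen_def)
  show ?thesis
    using assms
    by cases (auto simp: s o 0[of "Cli _", simplified] 0[of "Wey _", simplified]
        cli_op_cli_op cli_op_wey_op wey_op_wey_op)
qed

instantiation superalg :: (type, "{finite,linorder}", type, type) real_algebra_1
begin
lift_definition zero_superalg :: "('a, 'b, 'c, 'd) superalg" is "Const 0" .
lift_definition one_superalg :: "('a, 'b, 'c, 'd) superalg" is "Const 1" .
lift_definition plus_superalg ::
  "('a, 'b, 'c, 'd) superalg \<Rightarrow> ('a, 'b, 'c, 'd) superalg \<Rightarrow> ('a, 'b, 'c, 'd) superalg"
  is Add by (rule alg_eq.add_cong)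
lift_definition times_superalg ::
  "('a, 'b, 'c, 'd) superalg \<Rightarrow> ('a, 'b, 'c, 'd) superalg \<Rightarrow> ('a, 'b, 'c, 'd) superalg"
  is Mul by (rule alg_eq.mul_cong)
lift_definition scaleR_superalg ::
  "real \<Rightarrow> ('a, 'b, 'c, 'd) superalg \<Rightarrow> ('a, 'b, 'c, 'd) superalg"
  is "\<lambda>r. Mul (Const r)" by (intro alg_eq.mul_cong alg_eq.refl)
definition uminus_superalg :: "('a, 'b, 'c, 'd) superalg \<Rightarrow> ('a, 'b, 'c, 'd) superalg" where
  "uminus_superalg a = (-1) *\<^sub>R a"
definition minus_superalg ::
  "('a, 'b, 'c, 'd) superalg \<Rightarrow> ('a, 'b, 'c, 'd) superalg \<Rightarrow> ('a, 'b, 'c, 'd) superalg" where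
  "minus_superalg a b = a + - b"
instance
proof
  fix a b c :: "('a, 'b, 'c, 'd) superalg" and r s :: real
  show "a + b + c = a + (b + c)" by transfer (rule alg_eq.add_assoc)
  show "a + b = b + a" by transfer (rule alg_eq.add_comm)
  show "0 + a = a" by transfer (rule alg_eq.add_zero)
  show "- a + a = 0" unfolding uminus_superalg_def by transfer (rule alg_eq.add_neg)
  show "a - b = a + - b" by (rule minus_superalg_def)
  show "a * b * c = a * (b * c)" by transfer (rule alg_eq.mul_assoc)
  show "1 * a = a" by transfer (rule alg_eq.mul_one)
  show "a * 1 = a" by transfer (blast intro: alg_eq.intros)
  show "(a + b) * c = a * c + b * c" by transfer (rule alg_eq.distrib_right)
  show "a * (b + c) = a * b + a * c" by transfer (rule alg_eq.distrib_left)
  show "r *\<^sub>R (a + b) = r *\<^sub>R a + r *\<^sub>R b" by transfer (rule alg_eq.distrib_left)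
  show "(r + s) *\<^sub>R a = r *\<^sub>R a + s *\<^sub>R a"
    by transfer (meson alg_eq.distrib_right alg_eq.const_add alg_eq.mul_cong alg_eq.refl
        alg_eq.sym alg_eq.trans)
  show "r *\<^sub>R s *\<^sub>R a = (r * s) *\<^sub>R a"
    by transfer (meson alg_eq.mul_assoc alg_eq.const_mul alg_eq.mul_cong alg_eq.refl
        alg_eq.sym alg_eq.trans)
  show "1 *\<^sub>R a = a" by transfer (rule alg_eq.mul_one)
  show "r *\<^sub>R a * b = r *\<^sub>R (a * b)" by transfer (rule alg_eq.mul_assoc)
  show "a * r *\<^sub>R b = r *\<^sub>R (a * b)"
    by transfer (meson alg_eq.mul_assoc alg_eq.const_comm alg_eq.mul_cong alg_eq.refl
        alg_eq.sym alg_eq.trans)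
  show "(0::('a, 'b, 'c, 'd) superalg) \<noteq> 1"
  proof
    assume "(0::('a, 'b, 'c, 'd) superalg) = 1"
    then have "alg_eq superalg_rel (Const 0) (Const 1 :: ('a, 'b, 'c, 'd) gen alg_term)"
      by transfer
    from act_eq[OF linear_spinor_op act_spinor_op_rel this]
    have "v = 0" for v :: "('b, 'c) spinor" by simp
    from this[of "Spinor (\<lambda>A \<alpha>. 1)"] show False
      by (simp add: zero_spinor_def Spinor_inject fun_eq_iff)
  qed
qed
end

section \<open>Supervector variables and extended superbivectors\<close>

lift_definition gen :: "('s, 'm, 'n, 'l) gen \<Rightarrow> ('s, 'm, 'n, 'l) superalg" is Gen .

abbreviation egen :: "'m \<Rightarrow> ('s, 'm, 'n, 'l) superalg" where
  "egen j \<equiv> gen (Cli j)"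

abbreviation egen' :: "'n \<times> bool \<Rightarrow> ('s, 'm, 'n, 'l) superalg" where
  "egen' k \<equiv> gen (Wey k)"

definition f_monomial :: "'l::{finite,linorder} set \<Rightarrow> ('s, 'm::{finite,linorder}, 'n, 'l) superalg"
  where "f_monomial A = prod_list (map (\<lambda>k. gen (Gra k)) (sorted_list_of_set A))"

definition Grassmann_even :: "('s, 'm::{finite,linorder}, 'n, 'l::{finite,linorder}) superalg set"
  where "Grassmann_even = span {f_monomial A |A. even (card A)}"

definition Grassmann_odd :: "('s, 'm::{finite,linorder}, 'n, 'l::{finite,linorder}) superalg set"
  where "Grassmann_odd = span {f_monomial A |A. odd (card A)}"

text \<open>Coordinate columns have the index type \<open>'m + 'n \<times> bool\<close>.\<close>

definition supervector_of ::
  "(('s, 'm, 'n, 'l) superalg) ^ ('m + 'n \<times> bool) \<Rightarrow> ('s, 'm::{finite,linorder}, 'n::finite, 'l) superalg"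
  where "supervector_of y = (\<Sum>j\<in>UNIV. y $ Inl j * egen j) + (\<Sum>k\<in>UNIV. y $ Inr k * egen' k)"

definition coordinates ::
  "'s \<Rightarrow> (('s, 'm::{finite,linorder}, 'n::finite, 'l) superalg) ^ ('m + 'n \<times> bool)"
  where "coordinates s = (\<chi> i. case i of Inl j \<Rightarrow> gen (Bos s j) | Inr k \<Rightarrow> gen (Fer s k))"

definition supervector :: "'s \<Rightarrow> ('s, 'm::{finite,linorder}, 'n::finite, 'l) superalg" where
  "supervector s = supervector_of (coordinates s)"

definition sym_prod :: "'a::real_algebra \<Rightarrow> 'a \<Rightarrow> 'a" where
  "sym_prod a b = (1/2) *\<^sub>R (a * b + b * a)"

text \<open>The order of \<open>{1..2n}\<close>.\<close>

fun idx_le :: "'n::linorder \<times> bool \<Rightarrow> 'n \<times> bool \<Rightarrow> bool" where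
  "idx_le (j, a) (k, b) \<longleftrightarrow> j < k \<or> j = k \<and> a \<le> b"

definition ext_superbivectors ::
  "('s, 'm::{finite,linorder}, 'n::{finite,linorder}, 'l::{finite,linorder}) superalg set" where
  "ext_superbivectors =
    {(\<Sum>(j, k) | j < k. b j k * egen j * egen k) + (\<Sum>j\<in>UNIV. \<Sum>k\<in>UNIV. b' j k * egen j * egen' k)
       + (\<Sum>(j, k) | idx_le j k. B j k * sym_prod (egen' j) (egen' k)) |b b' B.
     (\<forall>j k. b j k \<in> Grassmann_even) \<and> (\<forall>j k. b' j k \<in> Grassmann_odd) \<and>
     (\<forall>j k. B j k \<in> Grassmann_even)}"

section \<open>Supermatrices\<close>

type_synonym ('s, 'm, 'n, 'l) smat =
  "(('s, 'm, 'n, 'l) superalg) ^ ('m + 'n \<times> bool) ^ ('m + 'n \<times> bool)"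

definition supermatrices ::
  "('s, 'm::{finite,linorder}, 'n::finite, 'l::{finite,linorder}) smat set" where
  "supermatrices = {M.
     (\<forall>i j. M $ Inl i $ Inl j \<in> Grassmann_even) \<and> (\<forall>i j. M $ Inl i $ Inr j \<in> Grassmann_odd) \<and>
     (\<forall>i j. M $ Inr i $ Inl j \<in> Grassmann_odd) \<and> (\<forall>i j. M $ Inr i $ Inr j \<in> Grassmann_even)}"

definition supertranspose ::
  "('s, 'm::{finite,linorder}, 'n::finite, 'l) smat \<Rightarrow> ('s, 'm, 'n, 'l) smat" where
  "supertranspose M = (\<chi> i j. case (i, j) of
     (Inr _, Inl _) \<Rightarrow> - M $ j $ i
   | _ \<Rightarrow> M $ j $ i)"

text \<open>The entries of \<open>\<Omega>\<^bsub>2n\<^esub>\<close> are the numbers \<^const>\<open>g_form\<close>.\<close>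

definition Q_matrix :: "('s, 'm::{finite,linorder}, 'n::finite, 'l) smat" where
  "Q_matrix = (\<chi> i j. case (i, j) of
     (Inl i', Inl j') \<Rightarrow> if i' = j' then 1 else 0
   | (Inr i', Inr j') \<Rightarrow> of_real (- (1/2) * g_form i' j')
   | _ \<Rightarrow> 0)"

definition so0 :: "('s, 'm::{finite,linorder}, 'n::finite, 'l::{finite,linorder}) smat set" where
  "so0 = {X \<in> supermatrices. supertranspose X ** Q_matrix + Q_matrix ** X = 0}"

section \<open>Lie algebras and the map \<open>\<phi>\<close>\<close>

definition lie_algebra :: "'a::real_vector set \<Rightarrow> ('a \<Rightarrow> 'a \<Rightarrow> 'a) \<Rightarrow> bool" where
  "lie_algebra L br \<longleftrightarrow>
     subspace L \<and>
     (\<forall>x\<in>L. \<forall>y\<in>L. br x y \<in> L) \<and>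
     (\<forall>x\<in>L. \<forall>y\<in>L. \<forall>z\<in>L. \<forall>r s. br (r *\<^sub>R x + s *\<^sub>R y) z = r *\<^sub>R br x z + s *\<^sub>R br y z) \<and>
     (\<forall>x\<in>L. \<forall>y\<in>L. \<forall>z\<in>L. \<forall>r s. br z (r *\<^sub>R x + s *\<^sub>R y) = r *\<^sub>R br z x + s *\<^sub>R br z y) \<and>
     (\<forall>x\<in>L. br x x = 0) \<and>
     (\<forall>x\<in>L. \<forall>y\<in>L. \<forall>z\<in>L. br x (br y z) + br y (br z x) + br z (br x y) = 0)"

definition lie_algebra_iso ::
  "'a::real_vector set \<Rightarrow> ('a \<Rightarrow> 'a \<Rightarrow> 'a) \<Rightarrow> 'b::real_vector set \<Rightarrow> ('b \<Rightarrow> 'b \<Rightarrow> 'b) \<Rightarrow> ('a \<Rightarrow> 'b) \<Rightarrow> bool"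
  where
  "lie_algebra_iso L br L' br' f \<longleftrightarrow>
     lie_algebra L br \<and> lie_algebra L' br' \<and>
     bij_betw f L L' \<and>
     (\<forall>x\<in>L. \<forall>y\<in>L. \<forall>r s. f (r *\<^sub>R x + s *\<^sub>R y) = r *\<^sub>R f x + s *\<^sub>R f y) \<and>
     (\<forall>x\<in>L. \<forall>y\<in>L. f (br x y) = br' (f x) (f y))"

definition commutator :: "'a::ring \<Rightarrow> 'a \<Rightarrow> 'a" where
  "commutator a b = a * b - b * a"

definition matrix_commutator :: "'a::ring_1 ^ 'k ^ 'k \<Rightarrow> 'a ^ 'k ^ 'k \<Rightarrow> 'a ^ 'k ^ 'k" where
  "matrix_commutator X Y = X ** Y - Y ** X"

definition represents_ad ::
  "('s, 'm::{finite,linorder}, 'n::finite, 'l::{finite,linorder}) smat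
    \<Rightarrow> ('s, 'm, 'n, 'l) superalg \<Rightarrow> bool" where
  "represents_ad M B \<longleftrightarrow> M \<in> supermatrices \<and>
     (\<forall>s. supervector_of (M *v coordinates s) = commutator B (supervector s))"

definition phi ::
  "('s, 'm::{finite,linorder}, 'n::finite, 'l::{finite,linorder}) superalg
    \<Rightarrow> ('s, 'm, 'n, 'l) smat" where
  "phi B = (THE M. represents_ad M B)"

end

theory Submission
  imports Defs "HOL-Library.Option_ord"
begin

text \<open>
  Write \<open>E\<^sub>i\<close> for the generators \<open>e\<^sub>j\<close> and \<open>e'\<^sub>k\<close> together, call the indices of the \<open>e\<^sub>j\<close> even and those of
  the \<open>e'\<^sub>k\<close> odd, and let \<open>\<sigma> i j\<close> be \<open>-1\<close> if both indices are odd and \<open>1\<close> otherwise. All relations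
  between the generators take the form \<open>E\<^sub>i E\<^sub>j + \<sigma> i j E\<^sub>j E\<^sub>i = h i j\<close> with the invertible matrix \<open>h = -2 Q\<close>
  (lemma \<open>basis_vec_relation\<close>). The superbivectors are the sums of \<open>C i j (E\<^sub>i \<and> E\<^sub>j)\<close>, where
  \<open>E\<^sub>i \<and> E\<^sub>j\<close> is half of \<open>E\<^sub>i E\<^sub>j - \<sigma> i j E\<^sub>j E\<^sub>i\<close> and \<open>C\<close> runs through the supermatrices that are super-skew,
  that is, \<open>C i j = - \<sigma> i j C j i\<close> (lemma \<open>ext_superbivectors_eq\<close>).

  The parities of the coefficients are such that moving scalars past each other turns commutators of
  superbivectors and supervectors into supercommutators of the \<open>E\<^sub>i\<close>. The rule for
  \<open>E\<^sub>i \<and> E\<^sub>j\<close> and \<open>E\<^sub>k\<close> then says that the superbivector with coefficients \<open>C\<close> acts on supervectors as the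
  matrix \<open>2 C h\<close> (lemma \<open>commutator_superbivector\<close>), and the rule for two wedge products says that
  superbivectors are closed under the commutator (lemma \<open>commutator_ext_superbivectors\<close>).

  With \<open>Q = - h / 2\<close>, the equation that defines \<open>so0\<close> holds for \<open>X = 2 C h\<close> exactly if \<open>C\<close> is super-skew
  (lemma \<open>ad_matrix_so0_iff\<close>). As \<open>h\<close> is invertible, \<open>C \<mapsto> 2 C h\<close> is a linear bijection from the
  super-skew supermatrices to \<open>so0\<close>. It factors through the superbivectors, and its second
  factor is \<open>phi\<close>; hence \<open>phi\<close> is a linear bijection. It respects brackets by the Jacobi identity.

  What remains is that \<open>phi\<close> is well defined: a supermatrix must be determined by its action on
  a supervector variable (lemma \<open>supermatrix_determined\<close>). The generators \<open>E\<^sub>i\<close> are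
  separated by contraction with \<open>h\<close>. For the coordinates, an explicit module over the
  presented algebra is needed to exclude unexpected relations; it is an exterior algebra with
  spinor coefficients (lemma \<open>coordinates_independent\<close>).
\<close>

section \<open>Signs and the form on the index set\<close>

text \<open>
  The sign that is picked up when two elements of parities \<open>p\<close> and \<open>q\<close> are exchanged.
\<close>

definition koszul :: "bool \<Rightarrow> bool \<Rightarrow> real" where
  "koszul p q = (if p \<and> q then -1 else 1)"

abbreviation odd_index :: "'a + 'b \<Rightarrow> bool" where
  "odd_index i \<equiv> \<not> isl i"

abbreviation index_sign :: "'a + 'b \<Rightarrow> 'a + 'b \<Rightarrow> real" where
  "index_sign i j \<equiv> koszul (odd_index i) (odd_index j)"

text \<open>
  The bilinear form \<open>h\<close> of the Clifford--Weyl relations is \<open>-2 I\<close> on the indices \<open>Inl j\<close> and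
  \<open>\<Omega>\<close> on the indices \<open>Inr k\<close>. Each of its rows has a single nonzero entry, whose column is given
  by an involution of the index set. Describing \<open>h\<close> by this involution and by the values of the
  entries makes every contraction with \<open>h\<close> a single term and makes \<open>h\<close> visibly invertible.
\<close>

definition partner :: "'m + 'n \<times> bool \<Rightarrow> 'm + 'n \<times> bool" where
  "partner i = (case i of Inl j \<Rightarrow> Inl j | Inr (k, a) \<Rightarrow> Inr (k, \<not> a))"

definition weight :: "'m + 'n \<times> bool \<Rightarrow> real" where
  "weight i = (case i of Inl j \<Rightarrow> -2 | Inr (k, a) \<Rightarrow> if a then -1 else 1)"

definition super_form :: "'m + 'n \<times> bool \<Rightarrow> 'm + 'n \<times> bool \<Rightarrow> real" where
  "super_form i j = (if j = partner i then weight i else 0)"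

lemma koszul_commute: "koszul p q = koszul q p"
  by (simp add: koszul_def)

lemma koszul_square [simp]: "koszul p q * koszul p q = 1"
  by (simp add: koszul_def)

lemma koszul_nonzero: "koszul p q \<noteq> 0"
  by (simp add: koszul_def)

lemma partner_partner [simp]: "partner (partner i) = i"
  by (cases i) (auto simp: partner_def)

lemma partner_eq_iff: "partner i = j \<longleftrightarrow> i = partner j"
  by (metis partner_partner)

lemma isl_partner [simp]: "isl (partner i) = isl i"
  by (cases i) (auto simp: partner_def)

lemma weight_nonzero [simp]: "weight i \<noteq> 0"
  by (cases i) (auto simp: weight_def split: if_splits)

lemma weight_partner: "weight (partner i) = index_sign i i * weight i"
  by (cases i) (auto simp: weight_def partner_def koszul_def)

lemma super_form_commute: "super_form j i = index_sign i j * super_form i j"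
  by (auto simp: super_form_def weight_partner partner_eq_iff)

lemma sum_super_form:
  fixes f :: "'m::finite + 'n::finite \<times> bool \<Rightarrow> 'v::real_vector"
  shows "(\<Sum>j\<in>UNIV. super_form j k *\<^sub>R f j) = weight (partner k) *\<^sub>R f (partner k)"
proof -
  have "super_form j k *\<^sub>R f j = (if j = partner k then weight (partner k) *\<^sub>R f (partner k) else 0)" for j
    by (auto simp: super_form_def partner_eq_iff)
  then show ?thesis by simp
qed

lemma super_form_nonzero: "super_form i j \<noteq> 0 \<Longrightarrow> isl i = isl j"
  by (auto simp: super_form_def split: if_splits)

section \<open>The Clifford--Weyl relations in one formula\<close>

definition basis_vec :: "'m + 'n \<times> bool \<Rightarrow> ('s, 'm, 'n, 'l) superalg" where
  "basis_vec i = (case i of Inl j \<Rightarrow> egen j | Inr k \<Rightarrow> egen' k)"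

lemma const_superalg:
  "abs_superalg (Const r) = r *\<^sub>R (1 :: ('s, 'm::{finite,linorder}, 'n, 'l) superalg)"
proof -
  have "alg_eq superalg_rel (Const r) (Mul (Const r) (Const 1))"
    by (metis alg_eq.const_mul alg_eq.sym mult.right_neutral)
  then show ?thesis
    by (simp add: one_superalg_def scaleR_superalg.abs_eq superalg.abs_eq_iff)
qed

lemma superalg_relI:
  fixes a b :: "('s, 'm::{finite,linorder}, 'n, 'l) gen alg_term"
  assumes "superalg_rel a b"
  shows "abs_superalg a = abs_superalg b"
  using assms by (simp add: superalg.abs_eq_iff alg_eq.rel)

lemmas abs_superalg_simps =
  plus_superalg.abs_eq[symmetric] times_superalg.abs_eq[symmetric] gen.abs_eq[symmetric]
  const_superalg

text \<open>
  Shifting the parity of the generators turns the Clifford--Weyl algebra into a Clifford algebra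
  in the super sense: the three families of relations differ only by the exchange sign. All later
  computations with generators rest on this one identity, so that no distinction between
  \<open>e\<^sub>j\<close> and \<open>e'\<^sub>k\<close> is needed.
\<close>

lemma basis_vec_relation:
  fixes i j :: "'m::{finite,linorder} + 'n \<times> bool"
  shows "basis_vec i * basis_vec j + index_sign i j *\<^sub>R (basis_vec j * basis_vec i) =
     super_form i j *\<^sub>R (1 :: ('s, 'm, 'n, 'l) superalg)"
proof -
  have cc: "egen j * egen k + egen k * egen j =
      (if j = k then -2 else 0) *\<^sub>R (1 :: ('s, 'm, 'n, 'l) superalg)" for j k
    using superalg_relI[OF superalg_rel.cli[of j k]] by (simp add: abs_superalg_simps)
  have cw: "egen j * egen' k + egen' k * egen j = (0 :: ('s, 'm, 'n, 'l) superalg)" for j k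
    using superalg_relI[OF superalg_rel.cli_wey[of _ j k, OF conjI[OF HOL.refl HOL.refl]]]
    by (simp add: abs_superalg_simps)
  have ww: "egen' j * egen' k - egen' k * egen' j =
      g_form j k *\<^sub>R (1 :: ('s, 'm, 'n, 'l) superalg)" for j k
    using superalg_relI[OF superalg_rel.wey[of j k]] by (simp add: abs_superalg_simps)
  show ?thesis
  proof (cases i; cases j)
    fix a b assume "i = Inr a" "j = Inr b"
    moreover have "g_form a b = super_form (Inr a :: 'm + 'n \<times> bool) (Inr b)"
      by (cases a; cases b) (auto simp: super_form_def partner_def weight_def)
    ultimately show ?thesis using ww[of a b] by (simp add: basis_vec_def koszul_def)
  qed (use cc cw in \<open>auto simp: basis_vec_def koszul_def super_form_def partner_def weight_def
        add.commute\<close>)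
qed

lemma basis_vec_swap:
  fixes i j :: "'m::{finite,linorder} + 'n \<times> bool"
  shows "basis_vec i * basis_vec j =
     super_form i j *\<^sub>R (1 :: ('s, 'm, 'n, 'l) superalg)
       - index_sign i j *\<^sub>R (basis_vec j * basis_vec i)"
  using basis_vec_relation[of i j] by (simp add: algebra_simps)

text \<open>
  The super-antisymmetrised product. It is \<open>e\<^sub>j e\<^sub>k\<close> for \<open>j \<noteq> k\<close>, it is \<open>e\<^sub>j e'\<^sub>k\<close> in the mixed case, and
  it is \<open>e'\<^sub>j \<odot> e'\<^sub>k\<close> for two odd indices, so that the superbivectors are its combinations with Grassmann coefficients.
\<close>

definition wedge :: "'m + 'n \<times> bool \<Rightarrow> 'm + 'n \<times> bool \<Rightarrow> ('s, 'm::{finite,linorder}, 'n, 'l) superalg"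
  where "wedge i j =
    (1/2) *\<^sub>R (basis_vec i * basis_vec j - index_sign i j *\<^sub>R (basis_vec j * basis_vec i))"

lemma wedge_eq:
  "wedge i j = basis_vec i * basis_vec j
     - (super_form i j / 2) *\<^sub>R (1 :: ('s, 'm::{finite,linorder}, 'n, 'l) superalg)"
proof -
  have "index_sign i j *\<^sub>R (basis_vec j * basis_vec i) = super_form i j *\<^sub>R 1
      - basis_vec i * (basis_vec j :: ('s, 'm, 'n, 'l) superalg)"
    using basis_vec_relation[of i j, where 's = 's and 'l = 'l] by (simp add: algebra_simps)
  then have "wedge i j = (1/2) *\<^sub>R (2 *\<^sub>R (basis_vec i * basis_vec j)
      - super_form i j *\<^sub>R (1 :: ('s, 'm, 'n, 'l) superalg))"
    by (simp add: wedge_def scaleR_2)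
  then show ?thesis by (simp add: scaleR_right_diff_distrib)
qed

lemma wedge_commute: "wedge j i = - index_sign i j *\<^sub>R wedge i j"
  by (simp add: wedge_def koszul_commute algebra_simps)

text \<open>
  Moving \<open>E\<^sub>k\<close> to the left through \<open>E\<^sub>i E\<^sub>j\<close> costs two exchange signs and leaves two contractions.
  The constant that separates \<open>E\<^sub>i E\<^sub>j\<close> from the wedge product is nonzero only if \<open>i\<close> and \<open>j\<close>
  have the same parity, and then the two signs cancel.
\<close>

lemma wedge_basis_vec:
  fixes i j k :: "'m::{finite,linorder} + 'n \<times> bool"
  shows "wedge i j * basis_vec k =
     (index_sign i k * index_sign j k) *\<^sub>R (basis_vec k * wedge i j)
       + super_form j k *\<^sub>R basis_vec i
       - (index_sign j k * super_form i k) *\<^sub>R (basis_vec j :: ('s, 'm, 'n, 'l) superalg)"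
proof -
  let ?E = "basis_vec :: 'm + 'n \<times> bool \<Rightarrow> ('s, 'm, 'n, 'l) superalg"
  have "?E i * ?E j * ?E k = ?E i * (?E j * ?E k)" by (rule mult.assoc)
  also have "\<dots> = super_form j k *\<^sub>R ?E i - index_sign j k *\<^sub>R (?E i * ?E k * ?E j)"
    unfolding basis_vec_swap[of j k] by (simp add: algebra_simps)
  also have "?E i * ?E k = super_form i k *\<^sub>R 1 - index_sign i k *\<^sub>R (?E k * ?E i)"
    by (rule basis_vec_swap)
  finally have *: "?E i * ?E j * ?E k =
     (index_sign i k * index_sign j k) *\<^sub>R (?E k * (?E i * ?E j)) + super_form j k *\<^sub>R ?E i
       - (index_sign j k * super_form i k) *\<^sub>R ?E j"
    by (simp add: algebra_simps)
  have "super_form i j * (index_sign i k * index_sign j k) = super_form i j"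
    by (cases "super_form i j = 0") (auto dest: super_form_nonzero)
  then show ?thesis
    unfolding wedge_eq
    by (simp add: * left_diff_distrib right_diff_distrib scaleR_diff_right mult.commute)
qed

text \<open>
  The supercommutator with a wedge product is a superderivation, so the rule for a single
  generator is applied to both factors of \<open>E\<^sub>k E\<^sub>l\<close>. Rewriting the four resulting products as wedge
  products produces constants; these cancel in pairs, because \<open>h\<close> is supersymmetric. Their
  cancellation is what makes the bracket of two superbivectors a superbivector again, without a
  scalar part.
\<close>

lemma wedge_wedge:
  fixes i j k l :: "'m::{finite,linorder} + 'n \<times> bool"
  shows "wedge i j * wedge k l =
     koszul (odd_index i \<noteq> odd_index j) (odd_index k \<noteq> odd_index l) *\<^sub>R (wedge k l * wedge i j)
       + super_form j k *\<^sub>R wedge i l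
       - (index_sign j k * super_form i k) *\<^sub>R wedge j l
       + (index_sign i k * index_sign j k * super_form j l) *\<^sub>R wedge k i
       - (index_sign i k * index_sign j k * index_sign j l * super_form i l)
           *\<^sub>R (wedge k j :: ('s, 'm, 'n, 'l) superalg)"
proof -
  let ?E = "basis_vec :: 'm + 'n \<times> bool \<Rightarrow> ('s, 'm, 'n, 'l) superalg"
  let ?W = "wedge :: _ \<Rightarrow> _ \<Rightarrow> ('s, 'm, 'n, 'l) superalg"
  let ?s = "index_sign :: 'm + 'n \<times> bool \<Rightarrow> _" and ?h = "super_form :: 'm + 'n \<times> bool \<Rightarrow> _"
  define t u where "t = ?s i k * ?s j k" and "u = ?s i l * ?s j l"
  have tu: "koszul (odd_index i \<noteq> odd_index j) (odd_index k \<noteq> odd_index l) = t * u"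
    unfolding t_def u_def by (auto simp: koszul_def)
  have EE: "?E a * ?E b = ?W a b + (?h a b / 2) *\<^sub>R 1" for a b
    by (simp add: wedge_eq)
  have "?W i j * (?E k * ?E l) = (?W i j * ?E k) * ?E l" by (simp add: mult.assoc)
  also have "\<dots> = t *\<^sub>R (?E k * (?W i j * ?E l)) + ?h j k *\<^sub>R (?E i * ?E l)
      - (?s j k * ?h i k) *\<^sub>R (?E j * ?E l)"
    unfolding wedge_basis_vec[of i j k] t_def by (simp add: algebra_simps)
  also have "?E k * (?W i j * ?E l) = u *\<^sub>R (?E k * ?E l * ?W i j) + ?h j l *\<^sub>R (?E k * ?E i)
      - (?s j l * ?h i l) *\<^sub>R (?E k * ?E j)"
    unfolding wedge_basis_vec[of i j l] u_def by (simp add: algebra_simps)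
  finally have *: "?W i j * (?W k l + (?h k l / 2) *\<^sub>R 1) =
      (t * u) *\<^sub>R ((?W k l + (?h k l / 2) *\<^sub>R 1) * ?W i j)
      + ?h j k *\<^sub>R ?W i l - (?s j k * ?h i k) *\<^sub>R ?W j l + (t * ?h j l) *\<^sub>R ?W k i
      - (t * ?s j l * ?h i l) *\<^sub>R ?W k j
      + ((?h j k * ?h i l - ?s j k * ?h i k * ?h j l + t * ?h j l * ?h k i
         - t * ?s j l * ?h i l * ?h k j) / 2) *\<^sub>R 1"
    unfolding EE by (simp add: algebra_simps add_divide_distrib diff_divide_distrib)
  have c1: "?s j k * ?h i k * ?h j l = t * ?h j l * ?h k i"
    by (auto simp: t_def super_form_commute[of k i] koszul_def)
  have c2: "?h j k * ?h i l = t * ?s j l * ?h i l * ?h k j"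
  proof (cases "?h j k = 0 \<or> ?h i l = 0")
    case True
    then show ?thesis by (auto simp: super_form_commute[of k j])
  next
    case False
    then have "isl j = isl k" "isl i = isl l" by (auto dest: super_form_nonzero)
    then show ?thesis by (auto simp: super_form_commute[of k j] t_def koszul_def)
  qed
  \<comment> \<open>the scalar part of the right-hand side\<close>
  have const: "?h j k * ?h i l - ?s j k * ?h i k * ?h j l + t * ?h j l * ?h k i
         - t * ?s j l * ?h i l * ?h k j = 0"
    unfolding c1 c2 by simp
  \<comment> \<open>the constant part of \<open>E\<^sub>k E\<^sub>l\<close> is the same on both sides of the exchange\<close>
  have tuh: "t * u * ?h k l = ?h k l"
    by (cases "?h k l = 0") (auto dest!: super_form_nonzero simp: t_def u_def koszul_def)
  have "?W i j * ?W k l + (?h k l / 2) *\<^sub>R ?W i j =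
      (t * u) *\<^sub>R (?W k l * ?W i j) + (t * u * ?h k l / 2) *\<^sub>R ?W i j
      + ?h j k *\<^sub>R ?W i l - (?s j k * ?h i k) *\<^sub>R ?W j l + (t * ?h j l) *\<^sub>R ?W k i
      - (t * ?s j l * ?h i l) *\<^sub>R ?W k j"
    using *[unfolded const] by (simp add: ring_distribs scaleR_add_right)
  then show ?thesis
    unfolding tuh unfolding tu t_def[symmetric] by simp
qed

section \<open>Grassmann coefficients and their parity\<close>

text \<open>
  The elements that behave like homogeneous elements of \<open>\<V> \<otimes> \<Lambda>\<^sub>N\<close> of parity \<open>q\<close>. The sign rule is
  imposed for the generators \<open>f\<^sub>k\<close> only; it extends to all Grassmann coefficients. The variables,
  the Grassmann numbers and the coordinates of \<open>M \<^bold>x\<close> for a supermatrix \<open>M\<close> all satisfy it, which is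
  why the action of a superbivector on \<open>\<^bold>x\<close> and its iterates can be computed by one lemma.
\<close>

definition parity_scalars :: "bool \<Rightarrow> ('s, 'm::{finite,linorder}, 'n, 'l) superalg set" where
  "parity_scalars q = {y. (\<forall>i. y * basis_vec i = basis_vec i * y) \<and>
     (\<forall>k. gen (Gra k) * y = koszul True q *\<^sub>R (y * gen (Gra k)))}"

definition grassmann :: "bool \<Rightarrow> ('s, 'm::{finite,linorder}, 'n, 'l::{finite,linorder}) superalg set" where
  "grassmann p = (if p then Grassmann_odd else Grassmann_even)"

lemma grassmann_eq_span: "grassmann p = span {f_monomial A |A. odd (card A) = p}"
  by (simp add: grassmann_def Grassmann_even_def Grassmann_odd_def)

lemma subspace_grassmann: "subspace (grassmann p)"
  by (simp add: grassmann_eq_span)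

lemma koszul_True_neq: "koszul True (p \<noteq> q) = koszul True p * koszul True q"
  by (simp add: koszul_def)

lemma subspace_parity_scalars: "subspace (parity_scalars q)"
  by (auto simp: subspace_def parity_scalars_def algebra_simps)

lemma parity_scalars_mult:
  assumes "x \<in> parity_scalars p" "y \<in> parity_scalars q"
  shows "x * y \<in> parity_scalars (p \<noteq> q)"
proof -
  have "x * y * basis_vec i = basis_vec i * (x * y)" for i
  proof -
    have "x * y * basis_vec i = x * basis_vec i * y"
      using assms(2) by (simp add: parity_scalars_def mult.assoc)
    also have "x * basis_vec i = basis_vec i * x"
      using assms(1) by (simp add: parity_scalars_def)
    finally show ?thesis by (simp add: mult.assoc)
  qed
  moreover have "gen (Gra k) * (x * y) = koszul True (p \<noteq> q) *\<^sub>R (x * y * gen (Gra k))" for k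
  proof -
    have "gen (Gra k) * (x * y) = (gen (Gra k) * x) * y" by (simp add: mult.assoc)
    also have "\<dots> = koszul True p *\<^sub>R (x * (gen (Gra k) * y))"
      using assms(1) by (simp add: parity_scalars_def mult.assoc)
    also have "\<dots> = (koszul True p * koszul True q) *\<^sub>R (x * y * gen (Gra k))"
      using assms(2) by (simp add: parity_scalars_def mult.assoc)
    finally show ?thesis by (simp only: koszul_True_neq)
  qed
  ultimately show ?thesis by (simp add: parity_scalars_def)
qed

lemma scalar_gen_commutes_basis_vec:
  assumes "scalar_gen u"
  shows "gen u * basis_vec i = basis_vec i * (gen u :: ('s, 'm::{finite,linorder}, 'n, 'l) superalg)"
proof (cases i)
  case (Inl j)
  then show ?thesis
    using superalg_relI[OF superalg_rel.scalar_cli[OF assms conjI[OF HOL.refl HOL.refl], of j]]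
    by (simp add: basis_vec_def abs_superalg_simps)
next
  case (Inr j)
  then show ?thesis
    using superalg_relI[OF superalg_rel.scalar_wey[OF assms conjI[OF HOL.refl HOL.refl], of j]]
    by (simp add: basis_vec_def abs_superalg_simps)
qed

lemma odd_scalar_gens_anticommute:
  assumes "odd_scalar_gen u" "odd_scalar_gen v"
  shows "gen u * gen v = - (gen v * (gen u :: ('s, 'm::{finite,linorder}, 'n, 'l) superalg))"
  using superalg_relI[OF superalg_rel.fer[OF assms conjI[OF HOL.refl HOL.refl]]]
  by (simp add: abs_superalg_simps add_eq_0_iff2)

lemma gen_Gra_parity: "gen (Gra k) \<in> parity_scalars True"
  by (auto simp: parity_scalars_def koszul_def scalar_gen_def odd_scalar_gen_def
      intro!: scalar_gen_commutes_basis_vec odd_scalar_gens_anticommute)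

lemma coordinates_parity: "coordinates s $ i \<in> parity_scalars (odd_index i)"
proof (cases i)
  case (Inl j)
  have "gen (Gra k) * gen (Bos s j) = (gen (Bos s j) * gen (Gra k) :: ('a, 'b, 'c, 'd) superalg)" for k
    using superalg_relI[OF superalg_rel.bos[OF _ conjI[OF HOL.refl HOL.refl],
          of "Gra k :: ('a, 'b, 'c, 'd) gen" s j]]
    by (simp add: abs_superalg_simps scalar_gen_def)
  then show ?thesis
    using Inl by (auto simp: coordinates_def parity_scalars_def koszul_def scalar_gen_def
        intro!: scalar_gen_commutes_basis_vec)
next
  case (Inr j)
  then show ?thesis
    by (auto simp: coordinates_def parity_scalars_def koszul_def scalar_gen_def odd_scalar_gen_def
        intro!: scalar_gen_commutes_basis_vec odd_scalar_gens_anticommute)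
qed

abbreviation gra_prod :: "'l list \<Rightarrow> ('s, 'm::{finite,linorder}, 'n, 'l) superalg" where
  "gra_prod xs \<equiv> prod_list (map (\<lambda>k. gen (Gra k)) xs)"

lemma gra_prod_parity: "gra_prod xs \<in> parity_scalars (odd (length xs))"
proof (induction xs)
  case Nil
  show ?case by (simp add: parity_scalars_def koszul_def)
next
  case (Cons k xs)
  show ?case using parity_scalars_mult[OF gen_Gra_parity[of k] Cons.IH] by simp
qed

lemma grassmann_parity: "grassmann p \<subseteq> parity_scalars p"
proof -
  have "f_monomial A \<in> parity_scalars (odd (card A))" for A
    using gra_prod_parity[of "sorted_list_of_set A"] by (simp add: f_monomial_def)
  then have "{f_monomial A |A. odd (card A) = p} \<subseteq> parity_scalars p" by blast
  then show ?thesis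
    unfolding grassmann_eq_span by (rule span_minimal[OF _ subspace_parity_scalars])
qed

lemma grassmann_supercommute:
  assumes "c \<in> grassmann p" "y \<in> parity_scalars q"
  shows "c * y = koszul p q *\<^sub>R (y * c)"
proof -
  have list: "gra_prod xs * y = koszul (odd (length xs)) q *\<^sub>R (y * gra_prod xs)" for xs
  proof (induction xs)
    case Nil
    show ?case by (simp add: koszul_def)
  next
    case (Cons k xs)
    have "gra_prod (k # xs) * y = gen (Gra k) * (gra_prod xs * y)" by (simp add: mult.assoc)
    also have "\<dots> = koszul (odd (length xs)) q *\<^sub>R ((gen (Gra k) * y) * gra_prod xs)"
      by (simp add: Cons.IH mult.assoc)
    also have "gen (Gra k) * y = koszul True q *\<^sub>R (y * gen (Gra k))"
      using assms(2) by (simp add: parity_scalars_def)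
    finally show ?case by (simp add: mult.assoc koszul_def)
  qed
  have "subspace {c. c * y = koszul p q *\<^sub>R (y * c)}"
    by (auto simp: subspace_def algebra_simps)
  moreover have "{f_monomial A |A. odd (card A) = p} \<subseteq> {c. c * y = koszul p q *\<^sub>R (y * c)}"
    using list by (auto simp: f_monomial_def)
  ultimately show ?thesis
    using assms(1) span_minimal unfolding grassmann_eq_span by blast
qed

text \<open>
  Sorting \<open>f\<^sub>k\<close> into an increasing monomial: each exchange changes the sign, and meeting \<open>f\<^sub>k\<close> itself
  gives zero.
\<close>

lemma gen_Gra_mult_gra_prod:
  assumes "sorted xs" "distinct xs"
  shows "gen (Gra k) * gra_prod xs = (0 :: ('s, 'm::{finite,linorder}, 'n, 'l::{finite,linorder}) superalg) \<or>
    k \<notin> set xs \<and> (\<exists>c. gen (Gra k) * gra_prod xs =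
       c *\<^sub>R (gra_prod (insort k xs) :: ('s, 'm, 'n, 'l) superalg))"
  using assms
proof (induction xs)
  case Nil
  show ?case by (auto intro: exI[of _ 1])
next
  case (Cons x xs)
  have anti: "gen (Gra a) * gen (Gra b) = - (gen (Gra b) * (gen (Gra a) :: ('s, 'm, 'n, 'l) superalg))"
    for a b by (rule odd_scalar_gens_anticommute) (auto simp: odd_scalar_gen_def)
  consider "k < x" | "k = x" | "x < k" by fastforce
  then show ?case
  proof cases
    case 1
    then have "k \<notin> set (x # xs)" using Cons.prems by auto
    then show ?thesis using 1 by (auto intro!: exI[of _ 1])
  next
    case 2
    have "gen (Gra x) * gen (Gra x) = (0 :: ('s, 'm, 'n, 'l) superalg)"
      using anti[of x x] by (simp add: eq_neg_iff_add_eq_0 flip: scaleR_2)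
    then show ?thesis using 2 by (simp flip: mult.assoc)
  next
    case 3
    have *: "gen (Gra k) * gra_prod (x # xs) =
        - (gen (Gra x) * (gen (Gra k) * gra_prod xs :: ('s, 'm, 'n, 'l) superalg))"
      using anti[of k x] by (simp flip: mult.assoc)
    from Cons.IH Cons.prems
    consider "gen (Gra k) * gra_prod xs = (0 :: ('s, 'm, 'n, 'l) superalg)"
      | c where "k \<notin> set xs"
        "gen (Gra k) * gra_prod xs = c *\<^sub>R (gra_prod (insort k xs) :: ('s, 'm, 'n, 'l) superalg)"
      by auto
    then show ?thesis
    proof cases
      case 1
      then show ?thesis using * by simp
    next
      case (2 c)
      have "gen (Gra k) * gra_prod (x # xs) =
          - (gen (Gra x) * (c *\<^sub>R (gra_prod (insort k xs) :: ('s, 'm, 'n, 'l) superalg)))"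
        unfolding * 2(2) ..
      also have "\<dots> = (- c) *\<^sub>R gra_prod (insort k (x # xs))"
        using 3 by auto
      finally have eq: "gen (Gra k) * gra_prod (x # xs) = (- c) *\<^sub>R
          (gra_prod (insort k (x # xs)) :: ('s, 'm, 'n, 'l) superalg)" .
      show ?thesis
        by (intro disjI2 conjI exI[of _ "- c"] eq) (use 2(1) 3 in auto)
    qed
  qed
qed

lemma gen_Gra_mult_grassmann:
  fixes c :: "('a, 'b::{finite,linorder}, 'c, 'd::{finite,linorder}) superalg"
  assumes "c \<in> grassmann p"
  shows "gen (Gra k) * c \<in> grassmann (\<not> p)"
proof -
  have monomial: "gen (Gra k) * f_monomial A \<in> (grassmann (\<not> odd (card A)) :: ('a, 'b, 'c, 'd) superalg set)" for A
  proof -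
    from gen_Gra_mult_gra_prod[of "sorted_list_of_set A" k, where 's = 'a and 'm = 'b and 'n = 'c]
    consider "gen (Gra k) * f_monomial A = (0 :: ('a, 'b, 'c, 'd) superalg)"
      | c where "k \<notin> A" "gen (Gra k) * f_monomial A =
         c *\<^sub>R (gra_prod (insort k (sorted_list_of_set A)) :: ('a, 'b, 'c, 'd) superalg)"
      unfolding f_monomial_def by auto
    then show ?thesis
    proof cases
      case 1
      then show ?thesis by (simp add: subspace_0 subspace_grassmann)
    next
      case (2 c)
      then have "gen (Gra k) * f_monomial A = c *\<^sub>R (f_monomial (insert k A) :: ('a, 'b, 'c, 'd) superalg)"
        by (simp add: f_monomial_def)
      moreover have "f_monomial (insert k A) \<in> (grassmann (even (card A)) :: ('a, 'b, 'c, 'd) superalg set)"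
        unfolding grassmann_eq_span
        by (rule span_base, intro CollectI exI[of _ "insert k A"]) (use 2(1) in simp)
      ultimately show ?thesis by (simp add: subspace_scale subspace_grassmann)
    qed
  qed
  let ?V = "{c. gen (Gra k) * c \<in> grassmann (\<not> p)} :: ('a, 'b, 'c, 'd) superalg set"
  have "{f_monomial A |A. odd (card A) = p} \<subseteq> ?V"
  proof
    fix x :: "('a, 'b, 'c, 'd) superalg" assume "x \<in> {f_monomial A |A. odd (card A) = p}"
    then obtain A where A: "x = f_monomial A" "p = odd (card A)" by blast
    show "x \<in> ?V"
      unfolding A by (rule CollectI, rule monomial)
  qed
  moreover have "subspace ?V"
    using subspace_grassmann[of "\<not> p"] by (auto simp: subspace_def ring_distribs)
  ultimately show ?thesis
    using assms span_minimal unfolding grassmann_eq_span[of p] by blast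
qed

text \<open>
  The span of the sorted monomials is closed under left multiplication by each \<open>f\<^sub>k\<close>, with a change
  of parity; a product of monomials is reached by iterating this.
\<close>

lemma grassmann_mult:
  assumes "c \<in> grassmann p" "d \<in> grassmann q"
  shows "c * d \<in> grassmann (p \<noteq> q)"
proof -
  have list: "gra_prod xs * d \<in> grassmann (odd (length xs) \<noteq> q)" for xs
  proof (induction xs)
    case (Cons k xs)
    have "gen (Gra k) * (gra_prod xs * d) \<in> grassmann (\<not> (odd (length xs) \<noteq> q))"
      by (rule gen_Gra_mult_grassmann[OF Cons.IH])
    moreover have "(\<not> (odd (length xs) \<noteq> q)) = (odd (length (k # xs)) \<noteq> q)" by auto
    ultimately show ?case by (simp add: mult.assoc)
  qed (use assms(2) in simp)
  have "f_monomial A * d \<in> grassmann (odd (card A) \<noteq> q)" for A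
    using list[of "sorted_list_of_set A"] by (simp add: f_monomial_def)
  then have "{f_monomial A |A. odd (card A) = p} \<subseteq> {c. c * d \<in> grassmann (p \<noteq> q)}" by blast
  moreover have "subspace {c. c * d \<in> grassmann (p \<noteq> q)}"
    using subspace_grassmann[of "p \<noteq> q"] by (auto simp: subspace_def ring_distribs)
  ultimately show ?thesis
    using assms(1) span_minimal unfolding grassmann_eq_span[of p] by blast
qed

lemma grassmann_expansion:
  assumes "c \<in> grassmann p"
  obtains r where "c = (\<Sum>A\<in>UNIV. r A *\<^sub>R f_monomial A)"
proof -
  let ?V = "range (\<lambda>r. \<Sum>A\<in>UNIV. r A *\<^sub>R f_monomial A) :: ('a, 'b, 'c, 'd) superalg set"
  have "{f_monomial A |A. odd (card A) = p} \<subseteq> ?V"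
  proof clarify
    fix A :: "'d set"
    show "f_monomial A \<in> ?V"
      by (rule range_eqI[of _ _ "\<lambda>B. if B = A then 1 else 0"])
        (simp add: if_distrib[of "\<lambda>r. r *\<^sub>R _"] cong: if_cong)
  qed
  moreover have "subspace ?V"
  proof (rule subspaceI)
    show "0 \<in> ?V" by (rule range_eqI[of _ _ "\<lambda>_. 0"]) simp
  next
    fix x y assume "x \<in> ?V" "y \<in> ?V"
    then obtain r s where "x = (\<Sum>A\<in>UNIV. r A *\<^sub>R f_monomial A)" "y = (\<Sum>A\<in>UNIV. s A *\<^sub>R f_monomial A)"
      by auto
    then have "x + y = (\<Sum>A\<in>UNIV. (r A + s A) *\<^sub>R f_monomial A)"
      by (simp add: scaleR_add_left sum.distrib)
    then show "x + y \<in> ?V" by (intro range_eqI[of _ _ "\<lambda>A. r A + s A"])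
  next
    fix t x assume "x \<in> ?V"
    then obtain r where "x = (\<Sum>A\<in>UNIV. r A *\<^sub>R f_monomial A)" by auto
    then have "t *\<^sub>R x = (\<Sum>A\<in>UNIV. (t * r A) *\<^sub>R f_monomial A)" by (simp add: scaleR_sum_right)
    then show "t *\<^sub>R x \<in> ?V" by (intro range_eqI[of _ _ "\<lambda>A. t * r A"])
  qed
  ultimately have "span {f_monomial A |A. odd (card A) = p} \<subseteq> ?V" by (rule span_minimal)
  then show ?thesis using assms that unfolding grassmann_eq_span by blast
qed

section \<open>Independence of the coordinates over the Grassmann algebra\<close>

text \<open>
  Left multiplication by a generator on an exterior algebra with coefficients in a vector space; the
  component at \<open>A\<close> is the coefficient of the increasing monomial with index set \<open>A\<close>.
\<close>

definition ext_mult :: "'a::{finite,linorder} \<Rightarrow> 'v::real_vector ^ 'a set \<Rightarrow> 'v ^ 'a set" where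
  "ext_mult a v = (\<chi> A. if a \<in> A then (\<Prod>b\<in>A. if b < a then -1 else 1) *\<^sub>R v $ (A - {a}) else 0)"

lemma linear_ext_mult: "linear (ext_mult a)"
  by (rule linearI) (auto simp: ext_mult_def vec_eq_iff algebra_simps)

lemma ext_mult_anticommute:
  fixes a b :: "'a::{finite,linorder}" and v :: "'v::real_vector ^ 'a set"
  shows "ext_mult a (ext_mult b v) + ext_mult b (ext_mult a v) = 0"
proof -
  define sg where "sg c A = (\<Prod>d\<in>A. if d < c then -1 else 1 :: real)" for c :: 'a and A
  have sg: "sg c A = (if d < c then -1 else 1) * sg c (A - {d})" if "d \<in> A" for c d A
    unfolding sg_def by (rule prod.remove) (use that in auto)
  have comp: "ext_mult c w $ A = (if c \<in> A then sg c A *\<^sub>R w $ (A - {c}) else 0)"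
    for c A and w :: "'v ^ 'a set"
    by (simp add: ext_mult_def sg_def)
  have "(ext_mult a (ext_mult b v) + ext_mult b (ext_mult a v)) $ A = 0" for A
  proof (cases "a \<in> A \<and> b \<in> A \<and> a \<noteq> b")
    case True
    have eq: "A - {a} - {b} = A - {a, b}" "A - {b} - {a} = A - {a, b}" by auto
    define X Y where "X = sg a (A - {b})" and "Y = sg b (A - {a})"
    have "sg a A = (if b < a then -1 else 1) * X" "sg b A = (if a < b then -1 else 1) * Y"
      unfolding X_def Y_def using True by (blast intro: sg)+
    then have "sg a A * Y + sg b A * X = 0"
      using True by (cases a b rule: linorder_cases) simp_all
    then have "sg a A * sg b (A - {a}) + sg b A * sg a (A - {b}) = 0"
      by (simp only: X_def Y_def)
    then show ?thesis
      using True by (auto simp: comp eq simp flip: scaleR_add_left)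
  qed (auto simp: comp)
  then show ?thesis by (simp add: vec_eq_iff)
qed

lemma ext_mult_axis:
  assumes "a \<notin> B"
  obtains r where "r \<noteq> 0" "\<And>v. ext_mult a (axis B v) = axis (insert a B) (r *\<^sub>R v)"
proof
  show "(\<Prod>b\<in>insert a B. if b < a then -1 else 1 :: real) \<noteq> 0" by simp
  fix v
  have "A - {a} = B \<and> a \<in> A \<longleftrightarrow> A = insert a B" for A using assms by auto
  then show "ext_mult a (axis B v) =
      axis (insert a B) ((\<Prod>b\<in>insert a B. if b < a then -1 else 1) *\<^sub>R v)"
    using assms by (auto simp: ext_mult_def axis_def vec_eq_iff)
qed

text \<open>
  A module in which the coordinates can be separated. It is the exterior algebra generated by the
  \<open>f\<^sub>k\<close> and one additional odd generator, labelled \<open>None\<close>, with coefficients in the spinors. For the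
  chosen index \<open>i\<close>, the coordinates with index \<open>i\<close> act as the identity if they are bosonic and as
  multiplication by the additional generator if they are fermionic; all other coordinates act
  as zero. The identity is a legitimate value for a commuting variable, and an additional generator is
  needed for a fermionic one, because every element of \<open>\<Lambda>\<^sub>N\<close> of odd degree is annihilated by
  \<open>f\<^sub>1 \<dots> f\<^sub>N\<close>.
\<close>

primrec detect_op ::
  "'m + 'n \<times> bool \<Rightarrow> ('s, 'm::{finite,linorder}, 'n, 'l::{finite,linorder}) gen
    \<Rightarrow> ('m, 'n) spinor ^ 'l option set \<Rightarrow> ('m, 'n) spinor ^ 'l option set" where
  "detect_op i (Bos s j) = (\<lambda>v. if i = Inl j then v else 0)"
| "detect_op i (Fer s k) = (\<lambda>v. if i = Inr k then ext_mult None v else 0)"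
| "detect_op i (Gra l) = ext_mult (Some l)"
| "detect_op i (Cli j) = (\<lambda>v. \<chi> A. cli_op j (v $ A))"
| "detect_op i (Wey k) = (\<lambda>v. \<chi> A. wey_op k (v $ A))"

lemma linear_cli_op: "linear (cli_op j)"
  using linear_spinor_op[of "Cli j"] by simp

lemma linear_wey_op: "linear (wey_op k)"
  using linear_spinor_op[of "Wey k"] by simp

lemma linear_componentwise:
  assumes "linear f"
  shows "linear (\<lambda>v. \<chi> A. f (v $ A))"
  by (rule linearI) (auto simp: vec_eq_iff linear_add[OF assms] linear_scale[OF assms])

lemma linear_detect_op: "linear (detect_op i u)"
proof (cases u)
  case (Bos s j)
  then show ?thesis by (auto intro!: linearI)
next
  case (Fer s k)
  then show ?thesis
    using linear_ext_mult[of None] by (cases "i = Inr k") (auto intro!: linearI)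
qed (simp_all add: linear_ext_mult linear_componentwise linear_cli_op linear_wey_op)

lemma ext_mult_componentwise:
  assumes "linear f"
  shows "ext_mult a (\<chi> A. f (v $ A)) = (\<chi> A. f (ext_mult a v $ A))"
  by (auto simp: ext_mult_def vec_eq_iff linear_0[OF assms] linear_scale[OF assms])

lemma act_detect_op_rel:
  fixes a b :: "('s, 'm::{finite,linorder}, 'n, 'l::{finite,linorder}) gen alg_term"
  assumes "superalg_rel a b"
  shows "act (detect_op i) a v = act (detect_op i) b v"
proof -
  note zero = linear_0[OF linear_ext_mult] linear_0[OF linear_cli_op] linear_0[OF linear_wey_op]
  note comp = ext_mult_componentwise[OF linear_cli_op] ext_mult_componentwise[OF linear_wey_op]
  have scalar_comp: "detect_op i u (\<chi> A. f (w $ A)) = (\<chi> A. f (detect_op i u w $ A))"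
    if "scalar_gen u" "linear f" for u :: "('s, 'm, 'n, 'l) gen" and f w
    using that by (auto simp: scalar_gen_def ext_mult_componentwise linear_0 vec_eq_iff)
  have bos_commutes: "detect_op i (Bos s j) (detect_op i u w) = detect_op i u (detect_op i (Bos s j) w)"
    for s j w and u :: "('s, 'm, 'n, 'l) gen"
    using linear_0[OF linear_detect_op[of i u]] by simp
  have odd: "detect_op i u (detect_op i u' w) + detect_op i u' (detect_op i u w) = 0"
    if "odd_scalar_gen u" "odd_scalar_gen u'" for u u' :: "('s, 'm, 'n, 'l) gen" and w
    using that by (auto simp: odd_scalar_gen_def ext_mult_anticommute zero)
  show ?thesis
    using assms
  proof cases
    case (bos u s j)
    then show ?thesis using bos_commutes by (simp del: detect_op.simps)
  next
    case (fer u u')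
    then show ?thesis by (simp add: odd del: detect_op.simps)
  next
    case (scalar_cli u j)
    then show ?thesis by (simp add: scalar_comp linear_cli_op)
  next
    case (scalar_wey u j)
    then show ?thesis by (simp add: scalar_comp linear_wey_op)
  qed (auto simp: vec_eq_iff cli_op_cli_op cli_op_wey_op wey_op_wey_op)
qed

lift_definition detect_rep ::
  "'m + 'n \<times> bool \<Rightarrow> ('s, 'm::{finite,linorder}, 'n, 'l::{finite,linorder}) superalg
    \<Rightarrow> ('m, 'n) spinor ^ 'l option set \<Rightarrow> ('m, 'n) spinor ^ 'l option set" is "\<lambda>i. act (detect_op i)"
  using act_eq[OF linear_detect_op act_detect_op_rel] by (intro ext) blast

lemma detect_rep_simps [simp]:
  "detect_rep i (a + b) v = detect_rep i a v + detect_rep i b v"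
  "detect_rep i (a * b) v = detect_rep i a (detect_rep i b v)"
  "detect_rep i (r *\<^sub>R a) v = r *\<^sub>R detect_rep i a v"
  "detect_rep i 0 v = 0"
  "detect_rep i 1 v = v"
  "detect_rep i (gen u) v = detect_op i u v"
  by (transfer; simp)+

lemma linear_detect_rep: "linear (detect_rep i a)"
  by transfer (rule linear_act[OF linear_detect_op])

lemma detect_rep_sum [simp]: "detect_rep i (\<Sum>x\<in>X. a x) v = (\<Sum>x\<in>X. detect_rep i (a x) v)"
  by (induction X rule: infinite_finite_induct) simp_all

lemma detect_rep_gra_prod:
  fixes xs :: "'l::{finite,linorder} list" and i :: "'m::{finite,linorder} + 'n \<times> bool"
  assumes "distinct xs" "B \<inter> Some ` set xs = {}"
  obtains r where "r \<noteq> 0"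
    "\<And>v. detect_rep i (gra_prod xs :: ('s, 'm, 'n, 'l) superalg) (axis B v) =
       axis (Some ` set xs \<union> B) (r *\<^sub>R v)"
proof -
  have "\<exists>r. r \<noteq> 0 \<and> (\<forall>v. detect_rep i (gra_prod xs :: ('s, 'm, 'n, 'l) superalg) (axis B v) = axis (Some ` set xs \<union> B) (r *\<^sub>R v))"
    using assms
  proof (induction xs)
    case Nil
    show ?case by (rule exI[of _ 1]) simp
  next
    case (Cons k xs)
    have "\<exists>r. r \<noteq> 0 \<and> (\<forall>v. detect_rep i (gra_prod xs :: ('s, 'm, 'n, 'l) superalg) (axis B v) =
        axis (Some ` set xs \<union> B) (r *\<^sub>R v))"
      by (rule Cons.IH) (use Cons.prems in auto)
    then obtain r where r: "r \<noteq> 0"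
      "\<And>v. detect_rep i (gra_prod xs :: ('s, 'm, 'n, 'l) superalg) (axis B v) =
         axis (Some ` set xs \<union> B) (r *\<^sub>R v)"
      by blast
    have "Some k \<notin> Some ` set xs \<union> B" using Cons.prems by auto
    then obtain q :: real where q: "q \<noteq> 0"
      "\<And>v :: ('m, 'n) spinor. ext_mult (Some k) (axis (Some ` set xs \<union> B) v) =
         axis (insert (Some k) (Some ` set xs \<union> B)) (q *\<^sub>R v)"
      by (rule ext_mult_axis) blast
    show ?case using r q by (intro exI[of _ "q * r"]) simp
  qed
  then show ?thesis using that by blast
qed

lemma detect_rep_coordinates:
  fixes i :: "'m::{finite,linorder} + 'n::finite \<times> bool"
  obtains r where "r \<noteq> 0"
    "\<And>v. detect_rep i (coordinates s $ i :: ('s, 'm, 'n, 'l::{finite,linorder}) superalg) (axis {} v) = axis (if isl i then {} else {None}) (r *\<^sub>R v)"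
proof (cases i)
  case (Inl j)
  then show ?thesis using that[of 1] by (simp add: coordinates_def)
next
  case (Inr k)
  obtain r :: real where "r \<noteq> 0"
    "\<And>v :: ('m, 'n) spinor. ext_mult (None :: 'l option) (axis {} v) = axis {None} (r *\<^sub>R v)"
    by (rule ext_mult_axis[of None "{}"]) auto
  then show ?thesis using Inr that[of r] by (simp add: coordinates_def)
qed

lemma detect_rep_other_coordinates: "l \<noteq> i \<Longrightarrow> detect_rep i (coordinates s $ l) v = 0"
  by (cases l) (auto simp: coordinates_def)

text \<open>
  Acting on the vacuum of the module for the index \<open>i\<close> removes all terms but the one with \<open>c i\<close>, and
  the monomials \<open>f\<^sub>A\<close> send the vacuum, or its product with the additional generator, to vectors
  supported at pairwise different sets. Hence the coefficients of \<open>c i\<close> vanish.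
\<close>

lemma coordinates_independent:
  fixes c :: "'m::{finite,linorder} + 'n::finite \<times> bool
    \<Rightarrow> ('s, 'm, 'n, 'l::{finite,linorder}) superalg"
  assumes "\<And>l. c l \<in> grassmann (p l)" and "(\<Sum>l\<in>UNIV. c l * coordinates s $ l) = 0"
  shows "c i = 0"
proof -
  define v :: "('m, 'n) spinor" where "v = Spinor (\<lambda>A \<alpha>. 1)"
  have v: "v \<noteq> 0" by (simp add: v_def zero_spinor_def Spinor_inject fun_eq_iff)
  obtain r where r: "c i = (\<Sum>A\<in>UNIV. r A *\<^sub>R f_monomial A)"
    using grassmann_expansion[OF assms(1)] by blast
  \<comment> \<open>the vacuum after the action of the coordinate with index \<open>i\<close> is supported at \<open>B\<close>\<close>
  define B :: "'l option set" where "B = (if isl i then {} else {None})"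
  obtain q where q: "q \<noteq> 0"
    "\<And>w. detect_rep i (coordinates s $ i :: ('s, 'm, 'n, 'l) superalg) (axis {} w) = axis B (q *\<^sub>R w)"
    unfolding B_def by (rule detect_rep_coordinates) blast
  have "\<exists>t. t \<noteq> 0 \<and> (\<forall>w. detect_rep i (f_monomial A :: ('s, 'm, 'n, 'l) superalg) (axis B w) =
      axis (Some ` A \<union> B) (t *\<^sub>R w))" for A
  proof -
    have "B \<inter> Some ` set (sorted_list_of_set A) = {}" by (auto simp: B_def)
    then show ?thesis
      by (rule detect_rep_gra_prod[of "sorted_list_of_set A" B i, where 's = 's, rotated])
        (auto simp: f_monomial_def)
  qed
  then obtain t where t: "\<And>A. t A \<noteq> 0"
    "\<And>A w. detect_rep i (f_monomial A :: ('s, 'm, 'n, 'l) superalg) (axis B w) =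
      axis (Some ` A \<union> B) (t A *\<^sub>R w)"
    by metis
  have scaleR_axis: "x *\<^sub>R axis C w = axis C (x *\<^sub>R w)"
    for x C and w :: "('m, 'n) spinor"
    by (simp add: axis_def vec_eq_iff)
  have "0 = detect_rep i (\<Sum>l\<in>UNIV. c l * coordinates s $ l) (axis {} v)"
    by (simp add: assms(2))
  also have "\<dots> = (\<Sum>l\<in>UNIV. if l = i then detect_rep i (c i) (axis B (q *\<^sub>R v)) else 0)"
    unfolding detect_rep_sum
    by (rule sum.cong) (auto simp: q(2) detect_rep_other_coordinates linear_0[OF linear_detect_rep])
  also have "\<dots> = (\<Sum>A\<in>UNIV. axis (Some ` A \<union> B) ((r A * (t A * q)) *\<^sub>R v))"
    by (simp add: r t(2) scaleR_axis)
  finally have sum: "(\<Sum>A\<in>UNIV. axis (Some ` A \<union> B) ((r A * (t A * q)) *\<^sub>R v)) = 0" by simp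
  have "r A = 0" for A
  proof -
    have inj: "Some ` A \<union> B = Some ` A' \<union> B \<longleftrightarrow> A' = A" for A'
      by (auto simp: B_def)
    have "0 = (\<Sum>A'\<in>UNIV. axis (Some ` A' \<union> B) ((r A' * (t A' * q)) *\<^sub>R v)) $ (Some ` A \<union> B)"
      by (simp add: sum)
    also have "\<dots> = (r A * (t A * q)) *\<^sub>R v"
      by (simp add: axis_def inj)
    finally show ?thesis using v q(1) t(1)[of A] by simp
  qed
  then show ?thesis by (simp add: r)
qed

text \<open>
  Coefficients that commute with the generators are isolated by contraction: the anticommutator
  with \<open>E\<^sub>j\<close> for an even index \<open>j\<close> yields the coefficient of \<open>E\<^sub>j\<close>, and once the even coefficients
  vanish, the commutator with \<open>E\<^sub>j\<close> for an odd index yields the coefficient of its partner.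
\<close>

lemma basis_vec_independent:
  fixes w :: "'m::{finite,linorder} + 'n::finite \<times> bool \<Rightarrow> ('s, 'm, 'n, 'l) superalg"
  assumes "\<And>i. w i \<in> parity_scalars (p i)" and zero: "(\<Sum>i\<in>UNIV. w i * basis_vec i) = 0"
  shows "w i = 0"
proof -
  have comm: "basis_vec j * w i = w i * basis_vec j" for i j
    using assms(1)[of i] by (simp add: parity_scalars_def)
  have *: "(\<Sum>i\<in>UNIV. w i * (basis_vec i * basis_vec j + s *\<^sub>R (basis_vec j * basis_vec i))) = 0" for s j
  proof -
    have "(\<Sum>i\<in>UNIV. w i * (basis_vec i * basis_vec j + s *\<^sub>R (basis_vec j * basis_vec i))) =
        (\<Sum>i\<in>UNIV. w i * basis_vec i) * basis_vec j + s *\<^sub>R (basis_vec j * (\<Sum>i\<in>UNIV. w i * basis_vec i))"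
      by (simp add: sum_distrib_left sum_distrib_right scaleR_sum_right ring_distribs sum.distrib
          mult.assoc[symmetric] comm)
    then show ?thesis by (simp add: zero)
  qed
  have even: "w (Inl j) = 0" for j
  proof -
    have "w i * (basis_vec i * basis_vec (Inl j) + 1 *\<^sub>R (basis_vec (Inl j) * basis_vec i)) =
        super_form i (Inl j) *\<^sub>R w i" for i
      using basis_vec_relation[of i "Inl j", where 's = 's and 'l = 'l] by (simp add: koszul_def)
    then have "weight (partner (Inl j)) *\<^sub>R w (partner (Inl j)) = 0"
      using *[where s = 1 and j = "Inl j"] sum_super_form[of "Inl j" w] by simp
    then show ?thesis by (simp add: partner_def)
  qed
  have odd: "w (Inr k) = 0" for k
  proof -
    have "w i * (basis_vec i * basis_vec (partner (Inr k)) + (-1) *\<^sub>R (basis_vec (partner (Inr k)) * basis_vec i)) =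
        super_form i (partner (Inr k)) *\<^sub>R w i" for i
      using basis_vec_relation[of i "partner (Inr k)", where 's = 's and 'l = 'l]
      by (cases i) (simp_all add: koszul_def even)
    then have "weight (Inr k) *\<^sub>R w (Inr k) = 0"
      using *[where s = "-1" and j = "partner (Inr k)"] sum_super_form[of "partner (Inr k)" w] by simp
    then show ?thesis by simp
  qed
  show ?thesis using even odd by (cases i) auto
qed

section \<open>Superbivectors as super-skew coefficient matrices\<close>

lemma sum_UNIV_sum:
  fixes f :: "'a::finite + 'b::finite \<Rightarrow> 'c::comm_monoid_add"
  shows "(\<Sum>i\<in>UNIV. f i) = (\<Sum>a\<in>UNIV. f (Inl a)) + (\<Sum>b\<in>UNIV. f (Inr b))"
  by (simp add: sum.Plus flip: UNIV_Plus_UNIV)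

lemma supervector_of_eq: "supervector_of y = (\<Sum>i\<in>UNIV. y $ i * basis_vec i)"
  by (simp add: supervector_of_def sum_UNIV_sum basis_vec_def)

text \<open>
  Replacing the three families of coefficients by one supermatrix makes the bracket relations
  uniform. The wedge product is super-antisymmetric, so only the super-skew part of the matrix
  matters; restricted to super-skew matrices the coefficients are determined by the element.
\<close>

definition superbivector ::
  "('s, 'm::{finite,linorder}, 'n::finite, 'l) smat \<Rightarrow> ('s, 'm, 'n, 'l) superalg" where
  "superbivector C = (\<Sum>i\<in>UNIV. \<Sum>j\<in>UNIV. C $ i $ j * wedge i j)"

definition super_skew ::
  "('s, 'm::{finite,linorder}, 'n::finite, 'l::{finite,linorder}) smat set" where
  "super_skew = {C \<in> supermatrices. \<forall>i j. C $ i $ j = - index_sign i j *\<^sub>R C $ j $ i}"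

lemma supermatrices_iff:
  "M \<in> supermatrices \<longleftrightarrow> (\<forall>i j. M $ i $ j \<in> grassmann (odd_index i \<noteq> odd_index j))"
proof
  assume M: "M \<in> supermatrices"
  have "M $ i $ j \<in> grassmann (odd_index i \<noteq> odd_index j)" for i j
    using M by (cases i; cases j) (auto simp: supermatrices_def grassmann_def)
  then show "\<forall>i j. M $ i $ j \<in> grassmann (odd_index i \<noteq> odd_index j)" by blast
next
  assume M: "\<forall>i j. M $ i $ j \<in> grassmann (odd_index i \<noteq> odd_index j)"
  show "M \<in> supermatrices"
    using M[rule_format, of "Inl _" "Inl _"] M[rule_format, of "Inl _" "Inr _"]
      M[rule_format, of "Inr _" "Inl _"] M[rule_format, of "Inr _" "Inr _"]
    by (simp add: supermatrices_def grassmann_def)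
qed

lemma subspace_supermatrices: "subspace supermatrices"
  by (rule subspaceI) (simp_all add: supermatrices_iff subspace_0 subspace_add subspace_scale
      subspace_grassmann)

lemma super_skewI:
  assumes "C \<in> supermatrices" "\<And>i j. C $ i $ j = - index_sign i j *\<^sub>R C $ j $ i"
  shows "C \<in> super_skew"
  unfolding super_skew_def using assms by blast

lemma super_skewD:
  assumes "C \<in> super_skew"
  shows "C \<in> supermatrices" "C $ i $ j = - index_sign i j *\<^sub>R C $ j $ i"
  using assms unfolding super_skew_def by blast+

lemma subspace_super_skew: "subspace super_skew"
proof (rule subspaceI; rule super_skewI)
  fix x y :: "('s, 'm::{finite,linorder}, 'n::finite, 'l::{finite,linorder}) smat" and r i j
  show "(0 :: ('s, 'm, 'n, 'l) smat) \<in> supermatrices"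
    by (rule subspace_0[OF subspace_supermatrices])
  show "(0 :: ('s, 'm, 'n, 'l) smat) $ i $ j = - index_sign i j *\<^sub>R 0 $ j $ i" by simp
  assume x: "x \<in> super_skew"
  show "r *\<^sub>R x \<in> supermatrices"
    by (rule subspace_scale[OF subspace_supermatrices super_skewD(1)[OF x]])
  show "(r *\<^sub>R x) $ i $ j = - index_sign i j *\<^sub>R (r *\<^sub>R x) $ j $ i"
    using super_skewD(2)[OF x, of i j] by (simp only: vector_scaleR_component scaleR_left_commute)
  assume y: "y \<in> super_skew"
  show "x + y \<in> supermatrices"
    by (rule subspace_add[OF subspace_supermatrices super_skewD(1)[OF x] super_skewD(1)[OF y]])
  show "(x + y) $ i $ j = - index_sign i j *\<^sub>R (x + y) $ j $ i"
    using super_skewD(2)[OF x, of i j] super_skewD(2)[OF y, of i j]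
    by (simp only: vector_add_component scaleR_add_right)
qed

lemma linear_superbivector: "linear superbivector"
  by (rule linearI) (simp_all add: superbivector_def ring_distribs sum.distrib scaleR_sum_right)

lemma sum_triangle:
  fixes F :: "'a::finite \<Rightarrow> 'a \<Rightarrow> 'v::real_vector"
  assumes total: "\<And>a b. le a b \<or> le b a" and antisym: "\<And>a b. le a b \<Longrightarrow> le b a \<Longrightarrow> a = b"
    and symm: "\<And>a b. F b a = F a b"
  shows "(\<Sum>a\<in>UNIV. \<Sum>b\<in>UNIV. F a b) =
    (\<Sum>(a, b) | le a b. (if a = b then 1 else 2 :: real) *\<^sub>R F a b)"
proof -
  let ?L = "{(a, b). le a b}" and ?S = "{(a, b). le a b \<and> a \<noteq> b}"
  have refl: "le a a" for a using total[of a a] by simp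
  have split: "(\<Sum>(a, b)\<in>?L. G a b) = (\<Sum>a\<in>UNIV. G a a) + (\<Sum>(a, b)\<in>?S. G a b)"
    for G :: "'a \<Rightarrow> 'a \<Rightarrow> 'v"
  proof -
    have "?L = (\<lambda>a. (a, a)) ` UNIV \<union> ?S" by (auto simp: refl)
    then have "(\<Sum>(a, b)\<in>?L. G a b) = (\<Sum>(a, b)\<in>(\<lambda>a. (a, a)) ` UNIV. G a b) + (\<Sum>(a, b)\<in>?S. G a b)"
      by (simp only:) (rule sum.union_disjoint; auto)
    then show ?thesis by (simp add: sum.reindex inj_on_def)
  qed
  have "(\<Sum>a\<in>UNIV. \<Sum>b\<in>UNIV. F a b) = (\<Sum>(a, b)\<in>UNIV. F a b)"
    by (simp add: sum.cartesian_product)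
  also have "UNIV = ?L \<union> prod.swap ` ?S"
  proof -
    have "x \<in> ?L \<union> prod.swap ` ?S" for x
      using total[of "fst x" "snd x"] refl by (cases x) (auto simp: image_iff)
    then show ?thesis by blast
  qed
  also have "(\<Sum>(a, b)\<in>?L \<union> prod.swap ` ?S. F a b) =
      (\<Sum>(a, b)\<in>?L. F a b) + (\<Sum>(a, b)\<in>prod.swap ` ?S. F a b)"
    using antisym by (intro sum.union_disjoint) auto
  also have "(\<Sum>(a, b)\<in>prod.swap ` ?S. F a b) = (\<Sum>(a, b)\<in>?S. F a b)"
    by (subst sum.reindex) (auto simp: symm intro!: sum.cong)
  also have "(\<Sum>(a, b)\<in>?L. F a b) + (\<Sum>(a, b)\<in>?S. F a b) =
      (\<Sum>a\<in>UNIV. F a a) + (\<Sum>(a, b)\<in>?S. 2 *\<^sub>R F a b)"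
  proof -
    have "(\<Sum>(a, b)\<in>?S. F a b) + (\<Sum>(a, b)\<in>?S. F a b) = (\<Sum>(a, b)\<in>?S. 2 *\<^sub>R F a b)"
      unfolding sum.distrib[symmetric] by (rule sum.cong) (auto simp: scaleR_2)
    then show ?thesis by (simp only: split[of F] add.assoc)
  qed
  also have "\<dots> = (\<Sum>(a, b) | le a b. (if a = b then 1 else 2 :: real) *\<^sub>R F a b)"
    unfolding split by (auto intro!: arg_cong2[of _ _ _ _ "(+)"] sum.cong)
  finally show ?thesis .
qed

lemma idx_le_total: "idx_le k l \<or> idx_le l k"
  by (cases k; cases l) auto

lemma idx_le_antisym: "idx_le k l \<Longrightarrow> idx_le l k \<Longrightarrow> k = l"
  by (cases k; cases l) auto

lemma wedge_Inl_Inl: "a \<noteq> b \<Longrightarrow> wedge (Inl a) (Inl b) = egen a * egen b"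
  by (simp add: wedge_eq super_form_def partner_def basis_vec_def)

lemma wedge_Inl_self: "wedge (Inl a) (Inl a) = 0"
  by (simp add: wedge_def koszul_def)

lemma wedge_Inl_Inr: "wedge (Inl a) (Inr k) = egen a * egen' k"
  by (simp add: wedge_eq super_form_def partner_def basis_vec_def split: prod.split)

lemma wedge_Inr_Inr: "wedge (Inr k) (Inr l) = sym_prod (egen' k) (egen' l)"
  by (simp add: wedge_def koszul_def sym_prod_def basis_vec_def)

text \<open>
  Super-skewness makes the summand symmetric in its two indices, so the sum over all pairs folds
  to the ordered pairs that occur in the normal form of a superbivector. Off the diagonal each
  term occurs twice; the diagonal terms of the even block vanish.
\<close>

lemma superbivector_super_skew:
  fixes C :: "('s, 'm::{finite,linorder}, 'n::{finite,linorder}, 'l::{finite,linorder}) smat"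
  assumes "C \<in> super_skew"
  shows "superbivector C =
    (\<Sum>(j, k) | j < k. (2 *\<^sub>R C $ Inl j $ Inl k) * egen j * egen k)
    + (\<Sum>j\<in>UNIV. \<Sum>k\<in>UNIV. (2 *\<^sub>R C $ Inl j $ Inr k) * egen j * egen' k)
    + (\<Sum>(j, k) | idx_le j k. ((if j = k then 1 else 2 :: real) *\<^sub>R C $ Inr j $ Inr k)
         * sym_prod (egen' j) (egen' k))"
proof -
  define F where "F i j = C $ i $ j * (wedge i j :: ('s, 'm, 'n, 'l) superalg)" for i j
  have symm: "F j i = F i j" for i j
  proof -
    have "C $ j $ i = - index_sign i j *\<^sub>R C $ i $ j"
      using super_skewD(2)[OF assms, of j i] by (simp only: koszul_commute)
    then show ?thesis by (simp add: F_def wedge_commute[of j i])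
  qed
  have ee: "(\<Sum>j\<in>UNIV. \<Sum>k\<in>UNIV. F (Inl j) (Inl k)) =
      (\<Sum>(j, k) | j < k. (2 *\<^sub>R C $ Inl j $ Inl k) * egen j * egen k)"
  proof -
    have "(\<Sum>j\<in>UNIV. \<Sum>k\<in>UNIV. F (Inl j) (Inl k)) =
        (\<Sum>(j, k) | j \<le> k. (if j = k then 1 else 2 :: real) *\<^sub>R F (Inl j) (Inl k))"
      by (rule sum_triangle[OF _ _ symm]) auto
    also have "\<dots> = (\<Sum>(j, k) | j < k. (if j = k then 1 else 2 :: real) *\<^sub>R F (Inl j) (Inl k))"
      by (rule sum.mono_neutral_right) (auto simp: F_def wedge_Inl_self le_less)
    also have "\<dots> = (\<Sum>(j, k) | j < k. (2 *\<^sub>R C $ Inl j $ Inl k) * egen j * egen k)"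
      by (rule sum.cong) (auto simp: F_def wedge_Inl_Inl mult.assoc)
    finally show ?thesis .
  qed
  have "(\<Sum>j\<in>UNIV. \<Sum>k\<in>UNIV. F (Inr j) (Inr k)) =
      (\<Sum>(j, k) | idx_le j k. (if j = k then 1 else 2 :: real) *\<^sub>R F (Inr j) (Inr k))"
    by (rule sum_triangle[OF idx_le_total idx_le_antisym symm])
  also have "\<dots> = (\<Sum>(j, k) | idx_le j k. ((if j = k then 1 else 2 :: real) *\<^sub>R C $ Inr j $ Inr k)
      * sym_prod (egen' j) (egen' k))"
    by (simp add: F_def wedge_Inr_Inr)
  finally have ww: "(\<Sum>j\<in>UNIV. \<Sum>k\<in>UNIV. F (Inr j) (Inr k)) = \<dots>" .
  have ew: "(\<Sum>j\<in>UNIV. \<Sum>k\<in>UNIV. F (Inl j) (Inr k)) + (\<Sum>j\<in>UNIV. \<Sum>k\<in>UNIV. F (Inr j) (Inl k)) =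
      (\<Sum>j\<in>UNIV. \<Sum>k\<in>UNIV. (2 *\<^sub>R C $ Inl j $ Inr k) * egen j * egen' k)"
  proof -
    have "(\<Sum>j\<in>UNIV. \<Sum>k\<in>UNIV. F (Inr j) (Inl k)) = (\<Sum>j\<in>UNIV. \<Sum>k\<in>UNIV. F (Inl j) (Inr k))"
      by (subst sum.swap) (simp add: symm[of "Inr _" "Inl _"])
    then show ?thesis
      by (simp add: F_def wedge_Inl_Inr mult.assoc flip: scaleR_2 scaleR_sum_right)
  qed
  have "superbivector C = (\<Sum>j\<in>UNIV. \<Sum>k\<in>UNIV. F (Inl j) (Inl k))
      + ((\<Sum>j\<in>UNIV. \<Sum>k\<in>UNIV. F (Inl j) (Inr k)) + (\<Sum>j\<in>UNIV. \<Sum>k\<in>UNIV. F (Inr j) (Inl k)))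
      + (\<Sum>j\<in>UNIV. \<Sum>k\<in>UNIV. F (Inr j) (Inr k))"
    by (simp add: superbivector_def F_def[symmetric] sum_UNIV_sum sum.distrib)
  then show ?thesis unfolding ee ew ww .
qed

lemma ext_superbivectors_eq: "ext_superbivectors = superbivector ` super_skew"
proof (intro equalityI subsetI)
  fix X :: "('s, 'm::{finite,linorder}, 'n::{finite,linorder}, 'l::{finite,linorder}) superalg"
  assume "X \<in> superbivector ` super_skew"
  then obtain C where C: "C \<in> super_skew" "X = superbivector C" by blast
  have "C $ Inl j $ Inl k \<in> Grassmann_even" "C $ Inl j $ Inr k' \<in> Grassmann_odd"
    "C $ Inr j' $ Inr k' \<in> Grassmann_even" for j k j' k'
    using super_skewD(1)[OF C(1)] unfolding supermatrices_def by blast+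
  then have "2 *\<^sub>R C $ Inl j $ Inl k \<in> Grassmann_even" "2 *\<^sub>R C $ Inl j $ Inr k' \<in> Grassmann_odd"
    "(if j' = k' then 1 else 2 :: real) *\<^sub>R C $ Inr j' $ Inr k' \<in> Grassmann_even" for j k j' k'
    unfolding Grassmann_even_def Grassmann_odd_def by (blast intro: span_scale)+
  then show "X \<in> ext_superbivectors"
    unfolding C(2) superbivector_super_skew[OF C(1)] ext_superbivectors_def
    by (intro CollectI exI[of _ "\<lambda>j k. 2 *\<^sub>R C $ Inl j $ Inl k"]
        exI[of _ "\<lambda>j k. 2 *\<^sub>R C $ Inl j $ Inr k"]
        exI[of _ "\<lambda>j k. (if j = k then 1 else 2 :: real) *\<^sub>R C $ Inr j $ Inr k"] conjI allI HOL.refl)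
next
  fix X :: "('s, 'm::{finite,linorder}, 'n::{finite,linorder}, 'l::{finite,linorder}) superalg"
  assume "X \<in> ext_superbivectors"
  then obtain b b' B where X: "X = (\<Sum>(j, k) | j < k. b j k * egen j * egen k)
      + (\<Sum>j\<in>UNIV. \<Sum>k\<in>UNIV. b' j k * egen j * egen' k)
      + (\<Sum>(j, k) | idx_le j k. B j k * sym_prod (egen' j) (egen' k))"
    and mem: "\<And>j k. b j k \<in> Grassmann_even" "\<And>j k. b' j k \<in> Grassmann_odd"
      "\<And>j k. B j k \<in> Grassmann_even"
    unfolding ext_superbivectors_def by blast
  define C :: "('s, 'm, 'n, 'l) smat" where "C = (\<chi> i j. case (i, j) of
      (Inl a, Inl b'') \<Rightarrow> if a < b'' then (1/2) *\<^sub>R b a b'' else if b'' < a then (-1/2) *\<^sub>R b b'' a else 0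
    | (Inl a, Inr k) \<Rightarrow> (1/2) *\<^sub>R b' a k
    | (Inr k, Inl a) \<Rightarrow> (-1/2) *\<^sub>R b' a k
    | (Inr k, Inr l) \<Rightarrow> if k = l then B k k else if idx_le k l then (1/2) *\<^sub>R B k l else (1/2) *\<^sub>R B l k)"
  have "C \<in> supermatrices"
    using mem by (auto simp: supermatrices_def C_def Grassmann_even_def Grassmann_odd_def
        intro!: span_neg span_scale span_zero)
  moreover have "C $ i $ j = - index_sign i j *\<^sub>R C $ j $ i" for i j
    using idx_le_total idx_le_antisym by (cases i; cases j) (auto simp: C_def koszul_def)
  ultimately have C: "C \<in> super_skew" by (rule super_skewI)
  have "X = superbivector C"
    unfolding X superbivector_super_skew[OF C]
    by (intro arg_cong2[of _ _ _ _ "(+)"] sum.cong HOL.refl) (auto simp: C_def)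
  then show "X \<in> superbivector ` super_skew" using C by blast
qed

lemma subspace_ext_superbivectors: "subspace ext_superbivectors"
  unfolding ext_superbivectors_eq
  by (rule linear_subspace_image[OF linear_superbivector subspace_super_skew])

text \<open>
  The coefficient matrix is the super-skew part of the matrix whose only nonzero entry is \<open>c\<close> at \<open>(i, j)\<close>.
\<close>

lemma mult_wedge_ext_superbivector:
  fixes c :: "('s, 'm::{finite,linorder}, 'n::{finite,linorder}, 'l::{finite,linorder}) superalg"
  assumes c: "c \<in> grassmann (odd_index i \<noteq> odd_index j)"
  shows "c * wedge i j \<in> ext_superbivectors"
proof -
  define U :: "_ \<Rightarrow> _ \<Rightarrow> ('s, 'm, 'n, 'l) smat" where "U i j = (\<chi> a b. if a = i \<and> b = j then c else 0)" for i j
  define C where "C = (1/2) *\<^sub>R (U i j - index_sign i j *\<^sub>R U j i)"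
  have U: "superbivector (U i j) = c * wedge i j" for i j
  proof -
    have "U i j $ a $ b * wedge a b = (if b = j then if a = i then c * wedge i j else 0 else 0)" for a b
      by (simp add: U_def)
    then show ?thesis by (simp add: superbivector_def)
  qed
  have "U i j \<in> supermatrices" "U j i \<in> supermatrices"
    using c by (cases "isl i"; cases "isl j";
        auto simp: supermatrices_iff U_def subspace_0[OF subspace_grassmann])+
  then have "C \<in> supermatrices"
    unfolding C_def by (intro subspace_scale subspace_diff subspace_supermatrices)
  moreover have "C $ a $ b = - index_sign a b *\<^sub>R C $ b $ a" for a b
  proof -
    define P R where "P = U i j $ a $ b" and "R = U j i $ a $ b"
    have flip: "U j i $ b $ a = P" "U i j $ b $ a = R"
      by (simp_all add: U_def P_def R_def conj_commute)
    \<comment> \<open>the unit matrices vanish except where the two signs agree\<close>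
    have P: "index_sign a b *\<^sub>R P = index_sign i j *\<^sub>R P"
      by (cases "a = i \<and> b = j") (auto simp: U_def P_def)
    have R: "index_sign a b *\<^sub>R R = index_sign i j *\<^sub>R R"
      by (cases "a = j \<and> b = i") (auto simp: U_def R_def koszul_commute)
    have PP: "index_sign a b *\<^sub>R (index_sign i j *\<^sub>R P) = P"
      by (simp only: scaleR_left_commute[of "index_sign a b"] P) simp
    have "- index_sign a b *\<^sub>R C $ b $ a =
        (1/2) *\<^sub>R (index_sign a b *\<^sub>R (index_sign i j *\<^sub>R P) - index_sign a b *\<^sub>R R)"
      by (simp add: C_def flip algebra_simps)
    also have "\<dots> = (1/2) *\<^sub>R (P - index_sign i j *\<^sub>R R)" by (simp only: PP R)
    also have "\<dots> = C $ a $ b" by (simp add: C_def P_def R_def)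
    finally show ?thesis ..
  qed
  ultimately have "C \<in> super_skew" by (rule super_skewI)
  moreover have "superbivector C = c * wedge i j"
    by (simp add: C_def linear_scale[OF linear_superbivector] linear_diff[OF linear_superbivector] U
        wedge_commute[of j i] flip: scaleR_2)
  ultimately show ?thesis unfolding ext_superbivectors_eq by force
qed

lemma commutator_sum_left: "commutator (\<Sum>x\<in>A. f x) b = (\<Sum>x\<in>A. commutator (f x) b)"
  by (simp add: commutator_def sum_distrib_left sum_distrib_right sum_subtractf)

lemma commutator_sum_right: "commutator b (\<Sum>x\<in>A. f x) = (\<Sum>x\<in>A. commutator b (f x))"
  by (simp add: commutator_def sum_distrib_left sum_distrib_right sum_subtractf)

lemma parity_scalars_wedge_commute:
  assumes "y \<in> parity_scalars q"
  shows "wedge i j * y = y * wedge i j"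
proof -
  have *: "basis_vec k * y = y * basis_vec k" for k
    using assms by (simp add: parity_scalars_def)
  have "basis_vec k * basis_vec l * y = y * (basis_vec k * basis_vec l)" for k l
  proof -
    have "basis_vec k * basis_vec l * y = (basis_vec k * y) * basis_vec l"
      by (simp only: *[of l] mult.assoc)
    then show ?thesis by (simp only: *[of k] mult.assoc)
  qed
  then show ?thesis by (simp add: wedge_eq ring_distribs algebra_simps)
qed

text \<open>
  Exchanging the coefficients \<open>c\<close> and \<open>d\<close> costs exactly the sign that turns the commutator into the
  supercommutator of the wedge products. A contraction \<open>h j k\<close> is nonzero only for equal parities,
  so the parity of \<open>c d\<close> fits the remaining pair of indices.
\<close>

lemma commutator_wedge_wedge_mem:
  fixes c d :: "('s, 'm::{finite,linorder}, 'n::{finite,linorder}, 'l::{finite,linorder}) superalg"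
  assumes c: "c \<in> grassmann (odd_index i \<noteq> odd_index j)"
    and d: "d \<in> grassmann (odd_index k \<noteq> odd_index l)"
  shows "commutator (c * wedge i j) (d * wedge k l) \<in> ext_superbivectors"
proof -
  let ?W = "wedge :: _ \<Rightarrow> _ \<Rightarrow> ('s, 'm, 'n, 'l) superalg"
  let ?s = "index_sign :: 'm + 'n \<times> bool \<Rightarrow> _" and ?h = "super_form :: 'm + 'n \<times> bool \<Rightarrow> _"
  define \<kappa> where "\<kappa> = koszul (odd_index i \<noteq> odd_index j) (odd_index k \<noteq> odd_index l)"
  have dc: "d * c = \<kappa> *\<^sub>R (c * d)"
    using grassmann_supercommute[OF d subsetD[OF grassmann_parity c]]
    by (simp add: \<kappa>_def koszul_commute)
  have Wd: "?W i j * d = d * ?W i j"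
    by (rule parity_scalars_wedge_commute[OF subsetD[OF grassmann_parity d]])
  have Wc: "?W k l * c = c * ?W k l"
    by (rule parity_scalars_wedge_commute[OF subsetD[OF grassmann_parity c]])
  have "c * ?W i j * (d * ?W k l) = c * (?W i j * d) * ?W k l" by (simp add: mult.assoc)
  also have "\<dots> = c * d * (?W i j * ?W k l)" unfolding Wd by (simp add: mult.assoc)
  finally have 1: "c * ?W i j * (d * ?W k l) = c * d * (?W i j * ?W k l)" .
  have "d * ?W k l * (c * ?W i j) = d * (?W k l * c) * ?W i j" by (simp add: mult.assoc)
  also have "\<dots> = d * c * (?W k l * ?W i j)" unfolding Wc by (simp add: mult.assoc)
  finally have 2: "d * ?W k l * (c * ?W i j) = \<kappa> *\<^sub>R (c * d * (?W k l * ?W i j))"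
    by (simp add: dc)
  have "commutator (c * ?W i j) (d * ?W k l) =
      ?h j k *\<^sub>R (c * d * ?W i l) - (?s j k * ?h i k) *\<^sub>R (c * d * ?W j l)
      + (?s i k * ?s j k * ?h j l) *\<^sub>R (c * d * ?W k i)
      - (?s i k * ?s j k * ?s j l * ?h i l) *\<^sub>R (c * d * ?W k j)"
    unfolding commutator_def 1 2 wedge_wedge[of i j k l] \<kappa>_def[symmetric]
    by (simp add: ring_distribs)
  also have "\<dots> \<in> ext_superbivectors"
  proof -
    have cd: "c * d \<in> grassmann ((odd_index i \<noteq> odd_index j) \<noteq> (odd_index k \<noteq> odd_index l))"
      by (rule grassmann_mult[OF c d])
    have summand: "r *\<^sub>R (c * d * ?W a b) \<in> ext_superbivectors"
      if "r \<noteq> 0 \<Longrightarrow> (odd_index a \<noteq> odd_index b) =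
        ((odd_index i \<noteq> odd_index j) \<noteq> (odd_index k \<noteq> odd_index l))" for r a b
    proof (cases "r = 0")
      case True
      then show ?thesis by (simp add: subspace_0[OF subspace_ext_superbivectors])
    next
      case False
      then show ?thesis
        using cd that
        by (intro subspace_scale subspace_ext_superbivectors mult_wedge_ext_superbivector) simp
    qed
    show ?thesis
      by (intro subspace_add subspace_diff subspace_ext_superbivectors summand)
        (auto dest: super_form_nonzero)
  qed
  finally show ?thesis .
qed

lemma commutator_ext_superbivectors:
  fixes X Y :: "('s, 'm::{finite,linorder}, 'n::{finite,linorder}, 'l::{finite,linorder}) superalg"
  assumes "X \<in> ext_superbivectors" "Y \<in> ext_superbivectors"
  shows "commutator X Y \<in> ext_superbivectors"
proof -
  obtain C D where CD: "C \<in> super_skew" "D \<in> super_skew"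
    and XY: "X = superbivector C" "Y = superbivector D"
    using assms unfolding ext_superbivectors_eq by blast
  have "C $ i $ j \<in> grassmann (odd_index i \<noteq> odd_index j)"
    "D $ i $ j \<in> grassmann (odd_index i \<noteq> odd_index j)" for i j
    using CD[THEN super_skewD(1)] unfolding supermatrices_iff by blast+
  then show ?thesis
    unfolding XY superbivector_def commutator_sum_left commutator_sum_right
    by (intro subspace_sum subspace_ext_superbivectors commutator_wedge_wedge_mem)
qed

section \<open>The adjoint action on supervectors\<close>

text \<open>
  This is \<open>2 C h\<close>.
\<close>

definition ad_matrix ::
  "('s, 'm::{finite,linorder}, 'n::finite, 'l) smat \<Rightarrow> ('s, 'm, 'n, 'l) smat" where
  "ad_matrix C = (\<chi> i k. (2 * weight (partner k)) *\<^sub>R C $ i $ partner k)"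

lemma commutator_wedge_basis_vec:
  fixes c y :: "('s, 'm::{finite,linorder}, 'n::{finite,linorder}, 'l::{finite,linorder}) superalg"
  assumes c: "c \<in> grassmann (odd_index i \<noteq> odd_index j)" and y: "y \<in> parity_scalars (odd_index k)"
  shows "commutator (c * wedge i j) (y * basis_vec k) =
    c * y * (super_form j k *\<^sub>R basis_vec i - (index_sign j k * super_form i k) *\<^sub>R basis_vec j)"
proof -
  let ?W = "wedge i j :: ('s, 'm, 'n, 'l) superalg" and ?E = "basis_vec k :: ('s, 'm, 'n, 'l) superalg"
  define \<kappa> where "\<kappa> = index_sign i k * index_sign j k"
  have "koszul (odd_index i \<noteq> odd_index j) (odd_index k) = \<kappa>"
    by (auto simp: \<kappa>_def koszul_def)
  then have cy: "c * y = \<kappa> *\<^sub>R (y * c)"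
    using grassmann_supercommute[OF c y] by simp
  have \<kappa>: "\<kappa> * \<kappa> = 1" by (simp add: \<kappa>_def koszul_def)
  have yc: "y * c = \<kappa> *\<^sub>R (c * y)" by (simp add: cy \<kappa>)
  have Ec: "?E * c = c * ?E"
    using subsetD[OF grassmann_parity c] by (simp add: parity_scalars_def)
  have Wy: "?W * y = y * ?W" by (rule parity_scalars_wedge_commute[OF y])
  have "c * ?W * (y * ?E) = c * (?W * y) * ?E" by (simp add: mult.assoc)
  also have "\<dots> = c * y * (?W * ?E)" unfolding Wy by (simp add: mult.assoc)
  finally have 1: "c * ?W * (y * ?E) = c * y * (?W * ?E)" .
  have "y * ?E * (c * ?W) = y * (?E * c) * ?W" by (simp add: mult.assoc)
  also have "\<dots> = \<kappa> *\<^sub>R (c * y * (?E * ?W))"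
    unfolding Ec by (simp add: yc flip: mult.assoc)
  finally have 2: "y * ?E * (c * ?W) = \<kappa> *\<^sub>R (c * y * (?E * ?W))" .
  show ?thesis
    unfolding commutator_def 1 2 wedge_basis_vec[of i j k] \<kappa>_def[symmetric]
    by (simp add: ring_distribs)
qed

text \<open>
  Each coefficient contributes two contractions. By super-skewness, the second becomes the first
  with the roles of the two indices interchanged, whence the factor 2 in \<open>2 C h\<close>. The statement is for
  general coordinates \<open>y\<close>, so that it can be applied to \<open>M \<^bold>x\<close> when two actions are composed.
\<close>

lemma commutator_superbivector:
  fixes C :: "('s, 'm::{finite,linorder}, 'n::{finite,linorder}, 'l::{finite,linorder}) smat"
  assumes C: "C \<in> super_skew" and y: "\<And>k. y $ k \<in> parity_scalars (odd_index k)"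
  shows "commutator (superbivector C) (supervector_of y) = supervector_of (ad_matrix C *v y)"
proof -
  let ?E = "basis_vec :: _ \<Rightarrow> ('s, 'm, 'n, 'l) superalg"
  have Cg: "C $ i $ j \<in> grassmann (odd_index i \<noteq> odd_index j)" for i j
    using super_skewD(1)[OF C] unfolding supermatrices_iff by blast
  define T where "T i j k = super_form j k *\<^sub>R (C $ i $ j * y $ k * ?E i)" for i j k
  have flip: "(index_sign j k * super_form i k) *\<^sub>R (C $ i $ j * y $ k * ?E j) = - T j i k" for i j k
  proof (cases "super_form i k = 0")
    case False
    then have "index_sign j k = index_sign i j"
      by (auto dest: super_form_nonzero simp: koszul_def)
    moreover have "C $ j $ i = - index_sign i j *\<^sub>R C $ i $ j"
      using super_skewD(2)[OF C, of j i] by (simp only: koszul_commute)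
    ultimately show ?thesis by (simp add: T_def mult.commute)
  qed (simp add: T_def)
  have "commutator (superbivector C) (supervector_of y) =
      (\<Sum>i\<in>UNIV. \<Sum>j\<in>UNIV. commutator (C $ i $ j * wedge i j) (supervector_of y))"
    unfolding superbivector_def commutator_sum_left ..
  also have "\<dots> =
      (\<Sum>i\<in>UNIV. \<Sum>j\<in>UNIV. \<Sum>k\<in>UNIV. commutator (C $ i $ j * wedge i j) (y $ k * ?E k))"
    unfolding supervector_of_eq commutator_sum_right ..
  also have "\<dots> = (\<Sum>i\<in>UNIV. \<Sum>j\<in>UNIV. \<Sum>k\<in>UNIV. T i j k + T j i k)"
  proof (intro sum.cong HOL.refl)
    fix i j k
    have "commutator (C $ i $ j * wedge i j) (y $ k * ?E k) =
        T i j k - (index_sign j k * super_form i k) *\<^sub>R (C $ i $ j * y $ k * ?E j)"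
      by (simp add: commutator_wedge_basis_vec[OF Cg y] T_def ring_distribs)
    then show "commutator (C $ i $ j * wedge i j) (y $ k * ?E k) = T i j k + T j i k"
      by (simp add: flip)
  qed
  also have "\<dots> = (\<Sum>i\<in>UNIV. \<Sum>j\<in>UNIV. \<Sum>k\<in>UNIV. 2 *\<^sub>R T i j k)"
  proof -
    have "(\<Sum>i\<in>UNIV. \<Sum>j\<in>UNIV. \<Sum>k\<in>UNIV. T j i k) = (\<Sum>i\<in>UNIV. \<Sum>j\<in>UNIV. \<Sum>k\<in>UNIV. T i j k)"
      by (rule sum.swap)
    then show ?thesis by (simp add: sum.distrib scaleR_2)
  qed
  also have "\<dots> = (\<Sum>i\<in>UNIV. \<Sum>k\<in>UNIV. \<Sum>j\<in>UNIV. 2 *\<^sub>R T i j k)"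
    by (rule sum.cong[OF HOL.refl], rule sum.swap)
  also have "\<dots> = (\<Sum>i\<in>UNIV. \<Sum>k\<in>UNIV. ad_matrix C $ i $ k * y $ k * ?E i)"
    unfolding scaleR_sum_right[symmetric] T_def sum_super_form
    by (simp add: ad_matrix_def scaleR_sum_right)
  also have "\<dots> = supervector_of (ad_matrix C *v y)"
    by (simp add: supervector_of_eq matrix_vector_mult_def sum_distrib_right)
  finally show ?thesis .
qed

lemma matrix_coordinates_parity:
  assumes "M \<in> supermatrices"
  shows "(M *v coordinates s) $ i \<in> parity_scalars (odd_index i)"
proof -
  have "M $ i $ j * coordinates s $ j \<in> parity_scalars (odd_index i)" for j
  proof -
    have "M $ i $ j \<in> parity_scalars (odd_index i \<noteq> odd_index j)"
      using assms grassmann_parity unfolding supermatrices_iff by blast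
    from parity_scalars_mult[OF this coordinates_parity[of s j]]
    have "M $ i $ j * coordinates s $ j \<in>
        parity_scalars ((odd_index i \<noteq> odd_index j) \<noteq> odd_index j)" .
    moreover have "((odd_index i \<noteq> odd_index j) \<noteq> odd_index j) = odd_index i" by auto
    ultimately show ?thesis by (simp only:)
  qed
  then show ?thesis
    by (simp add: matrix_vector_mult_def subspace_sum[OF subspace_parity_scalars])
qed

lemma supervector_of_diff: "supervector_of (x - y) = supervector_of x - supervector_of y"
  by (simp add: supervector_of_eq ring_distribs sum_subtractf)

text \<open>
  A supermatrix can be read off from its action on a supervector variable: first the
  generators and then the coordinates are independent over the coefficients.
\<close>

lemma supermatrix_determined:
  fixes M M' :: "('s, 'm::{finite,linorder}, 'n::finite, 'l::{finite,linorder}) smat"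
  assumes M: "M \<in> supermatrices" "M' \<in> supermatrices"
    and eq: "supervector_of (M *v coordinates s) = supervector_of (M' *v coordinates s)"
  shows "M = M'"
proof -
  have D: "M - M' \<in> supermatrices" by (rule subspace_diff[OF subspace_supermatrices M])
  have "(\<Sum>i\<in>UNIV. ((M - M') *v coordinates s) $ i * basis_vec i) = 0"
    using eq unfolding supervector_of_eq[symmetric] matrix_vector_mult_diff_rdistrib supervector_of_diff
    by simp
  from basis_vec_independent[OF matrix_coordinates_parity[OF D] this]
  have zero: "(\<Sum>l\<in>UNIV. (M - M') $ i $ l * coordinates s $ l) = 0" for i
    by (simp add: matrix_vector_mult_def)
  have "(M - M') $ i $ j = 0" for i j
    by (rule coordinates_independent[where p = "\<lambda>l. odd_index i \<noteq> odd_index l", OF _ zero])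
      (use D supermatrices_iff in blast)
  then show ?thesis by (simp add: vec_eq_iff)
qed

lemma represents_ad_unique:
  assumes "represents_ad M B" "represents_ad M' B"
  shows "M = M'"
  \<comment> \<open>any supervector variable will do\<close>
  using assms by (intro supermatrix_determined[where s = undefined]) (simp_all add: represents_ad_def)

lemma phi_eq: "represents_ad M B \<Longrightarrow> phi B = M"
  unfolding phi_def using represents_ad_unique by blast

section \<open>The Lie algebra of supermatrices\<close>

lemma ad_matrix_supermatrices:
  assumes "C \<in> supermatrices"
  shows "ad_matrix C \<in> supermatrices"
  unfolding supermatrices_iff
proof (intro allI)
  fix i k
  have "C $ i $ partner k \<in> grassmann (odd_index i \<noteq> odd_index (partner k))"
    using assms unfolding supermatrices_iff by blast
  then show "ad_matrix C $ i $ k \<in> grassmann (odd_index i \<noteq> odd_index k)"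
    by (simp add: ad_matrix_def subspace_scale[OF subspace_grassmann])
qed

lemma linear_ad_matrix: "linear ad_matrix"
  by (rule linearI) (simp_all add: ad_matrix_def vec_eq_iff algebra_simps)

text \<open>
  The inverse of \<open>C \<mapsto> 2 C h\<close>.
\<close>

definition coeff_matrix ::
  "('s, 'm::{finite,linorder}, 'n::finite, 'l) smat \<Rightarrow> ('s, 'm, 'n, 'l) smat" where
  "coeff_matrix X = (\<chi> i j. (1 / (2 * weight j)) *\<^sub>R X $ i $ partner j)"

lemma ad_coeff_matrix: "ad_matrix (coeff_matrix X) = X"
  by (simp add: ad_matrix_def coeff_matrix_def vec_eq_iff)

lemma coeff_ad_matrix: "coeff_matrix (ad_matrix C) = C"
  by (simp add: ad_matrix_def coeff_matrix_def vec_eq_iff)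

lemma coeff_matrix_supermatrices:
  assumes "X \<in> supermatrices"
  shows "coeff_matrix X \<in> supermatrices"
  unfolding supermatrices_iff
proof (intro allI)
  fix i j
  have "X $ i $ partner j \<in> grassmann (odd_index i \<noteq> odd_index (partner j))"
    using assms unfolding supermatrices_iff by blast
  then show "coeff_matrix X $ i $ j \<in> grassmann (odd_index i \<noteq> odd_index j)"
    by (simp add: coeff_matrix_def subspace_scale[OF subspace_grassmann])
qed

lemma Q_matrix_nth: "Q_matrix $ i $ j = (- (1/2) * super_form i j) *\<^sub>R 1"
proof (cases i; cases j)
  fix a b assume "i = Inr a" "j = Inr b"
  moreover have "g_form a b = super_form (Inr a :: 'b + 'c \<times> bool) (Inr b)"
    by (cases a; cases b) (auto simp: super_form_def partner_def weight_def)
  ultimately show ?thesis by (simp add: Q_matrix_def of_real_def)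
qed (auto simp: Q_matrix_def super_form_def partner_def weight_def)

lemma supertranspose_nth:
  "supertranspose X $ i $ j = (index_sign i i * index_sign i j) *\<^sub>R X $ j $ i"
  by (cases i; cases j) (simp_all add: supertranspose_def koszul_def)

text \<open>
  Since \<open>Q = - h / 2\<close>, the defining expression of \<open>so0\<close> at \<open>X = 2 C h\<close> is, up to nonzero factors in the
  entries, \<open>h Z h\<close>, where \<open>Z\<close> measures the failure of \<open>C\<close> to be super-skew; and \<open>h\<close> is
  invertible.
\<close>

lemma ad_matrix_so0_iff:
  fixes C :: "('s, 'm::{finite,linorder}, 'n::finite, 'l::{finite,linorder}) smat"
  assumes "C \<in> supermatrices"
  shows "ad_matrix C \<in> so0 \<longleftrightarrow> C \<in> super_skew"
proof -
  let ?X = "ad_matrix C"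
  have entry: "(supertranspose ?X ** Q_matrix + Q_matrix ** ?X) $ i $ j =
      - (index_sign i i * weight (partner i) * weight (partner j)) *\<^sub>R
        (C $ partner i $ partner j + index_sign i j *\<^sub>R C $ partner j $ partner i)" for i j
  proof -
    have "(supertranspose ?X ** Q_matrix) $ i $ j =
        - (1/2) *\<^sub>R (\<Sum>k\<in>UNIV. super_form k j *\<^sub>R supertranspose ?X $ i $ k)"
      by (simp add: matrix_matrix_mult_def Q_matrix_nth scaleR_sum_right)
    also have "\<dots> = - (1/2) *\<^sub>R (weight (partner j) *\<^sub>R supertranspose ?X $ i $ partner j)"
      by (simp only: sum_super_form)
    also have "\<dots> = - (index_sign i i * index_sign i j * weight (partner i) * weight (partner j))
        *\<^sub>R C $ partner j $ partner i"
      by (simp add: supertranspose_nth ad_matrix_def)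
    finally have 1: "(supertranspose ?X ** Q_matrix) $ i $ j = \<dots>" .
    have "super_form i k *\<^sub>R ?X $ k $ j = (if k = partner i then weight i *\<^sub>R ?X $ partner i $ j else 0)" for k
      by (simp add: super_form_def)
    then have "(\<Sum>k\<in>UNIV. super_form i k *\<^sub>R ?X $ k $ j) = weight i *\<^sub>R ?X $ partner i $ j"
      by simp
    moreover have "(Q_matrix ** ?X) $ i $ j = - (1/2) *\<^sub>R (\<Sum>k\<in>UNIV. super_form i k *\<^sub>R ?X $ k $ j)"
      by (simp add: matrix_matrix_mult_def Q_matrix_nth scaleR_sum_right)
    moreover have "weight i = index_sign i i * weight (partner i)"
      using weight_partner[of "partner i"] by simp
    ultimately have 2: "(Q_matrix ** ?X) $ i $ j =
        - (index_sign i i * weight (partner i) * weight (partner j)) *\<^sub>R C $ partner i $ partner j"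
      by (simp add: ad_matrix_def)
    show ?thesis by (simp add: 1 2 algebra_simps)
  qed
  have "ad_matrix C \<in> so0 \<longleftrightarrow>
      (\<forall>i j. (supertranspose ?X ** Q_matrix + Q_matrix ** ?X) $ i $ j = 0)"
    using ad_matrix_supermatrices[OF assms] by (simp add: so0_def vec_eq_iff)
  also have "\<dots> \<longleftrightarrow>
      (\<forall>i j. C $ partner i $ partner j + index_sign i j *\<^sub>R C $ partner j $ partner i = 0)"
    unfolding entry by (simp only: scaleR_eq_0_iff) (simp add: koszul_nonzero)
  also have "\<dots> \<longleftrightarrow> (\<forall>i j. C $ i $ j + index_sign i j *\<^sub>R C $ j $ i = 0)" (is "?L \<longleftrightarrow> ?R")
  proof
    assume ?L
    show ?R
    proof (intro allI)
      fix i j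
      show "C $ i $ j + index_sign i j *\<^sub>R C $ j $ i = 0"
        using \<open>?L\<close>[rule_format, of "partner i" "partner j"] by simp
    qed
  next
    assume ?R
    show ?L
    proof (intro allI)
      fix i j
      show "C $ partner i $ partner j + index_sign i j *\<^sub>R C $ partner j $ partner i = 0"
        using \<open>?R\<close>[rule_format, of "partner i" "partner j"] by simp
    qed
  qed
  also have "\<dots> \<longleftrightarrow> (\<forall>i j. C $ i $ j = - index_sign i j *\<^sub>R C $ j $ i)"
    by (simp add: add_eq_0_iff2)
  also have "\<dots> \<longleftrightarrow> C \<in> super_skew"
    using assms unfolding super_skew_def by blast
  finally show ?thesis .
qed

lemma so0_eq: "so0 = ad_matrix ` super_skew"
proof (intro equalityI subsetI)
  fix X :: "('s, 'm::{finite,linorder}, 'n::finite, 'l::{finite,linorder}) smat"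
  assume X: "X \<in> so0"
  then have "X \<in> supermatrices" by (simp add: so0_def)
  then have "coeff_matrix X \<in> super_skew"
    using ad_matrix_so0_iff[OF coeff_matrix_supermatrices] X unfolding ad_coeff_matrix by blast
  then show "X \<in> ad_matrix ` super_skew"
    by (rule image_eqI[where x = "coeff_matrix X", rotated]) (simp add: ad_coeff_matrix)
next
  fix X :: "('s, 'm::{finite,linorder}, 'n::finite, 'l::{finite,linorder}) smat"
  assume "X \<in> ad_matrix ` super_skew"
  then show "X \<in> so0" using ad_matrix_so0_iff super_skewD(1) by blast
qed

lemma represents_ad_superbivector:
  fixes C :: "('s, 'm::{finite,linorder}, 'n::{finite,linorder}, 'l::{finite,linorder}) smat"
  assumes "C \<in> super_skew"
  shows "represents_ad (ad_matrix C) (superbivector C)"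
  unfolding represents_ad_def supervector_def
  using ad_matrix_supermatrices[OF super_skewD(1)[OF assms]]
    commutator_superbivector[OF assms coordinates_parity] by simp

lemma phi_superbivector:
  fixes C :: "('s, 'm::{finite,linorder}, 'n::{finite,linorder}, 'l::{finite,linorder}) smat"
  assumes "C \<in> super_skew"
  shows "phi (superbivector C) = ad_matrix C"
  by (rule phi_eq[OF represents_ad_superbivector[OF assms]])

lemma represents_ad_phi:
  fixes B :: "('s, 'm::{finite,linorder}, 'n::{finite,linorder}, 'l::{finite,linorder}) superalg"
  assumes "B \<in> ext_superbivectors"
  shows "represents_ad (phi B) B"
proof -
  obtain C where "C \<in> super_skew" "B = superbivector C"
    using assms unfolding ext_superbivectors_eq by blast
  then show ?thesis by (simp add: phi_superbivector represents_ad_superbivector)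
qed

lemma bij_betw_phi: "bij_betw phi ext_superbivectors
  (so0 :: ('s, 'm::{finite,linorder}, 'n::{finite,linorder}, 'l::{finite,linorder}) smat set)"
proof (rule bij_betw_imageI)
  show "inj_on phi (ext_superbivectors :: ('s, 'm, 'n, 'l) superalg set)"
    unfolding ext_superbivectors_eq
    by (rule inj_onI) (metis (no_types, lifting) coeff_ad_matrix image_iff phi_superbivector)
  show "phi ` ext_superbivectors = (so0 :: ('s, 'm, 'n, 'l) smat set)"
    unfolding ext_superbivectors_eq so0_eq image_image
    by (rule image_cong) (simp_all add: phi_superbivector)
qed

lemma phi_linear:
  fixes X Y :: "('s, 'm::{finite,linorder}, 'n::{finite,linorder}, 'l::{finite,linorder}) superalg"
  assumes "X \<in> ext_superbivectors" "Y \<in> ext_superbivectors"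
  shows "phi (r *\<^sub>R X + t *\<^sub>R Y) = r *\<^sub>R phi X + t *\<^sub>R phi Y"
proof -
  obtain C D where CD: "C \<in> super_skew" "D \<in> super_skew"
    and XY: "X = superbivector C" "Y = superbivector D"
    using assms unfolding ext_superbivectors_eq by blast
  have "r *\<^sub>R C + t *\<^sub>R D \<in> super_skew"
    using CD by (intro subspace_add subspace_scale subspace_super_skew)
  from phi_superbivector[OF this] show ?thesis
    by (simp add: XY CD phi_superbivector linear_add[OF linear_superbivector]
        linear_scale[OF linear_superbivector] linear_add[OF linear_ad_matrix]
        linear_scale[OF linear_ad_matrix])
qed

lemma supermatrices_mult:
  assumes "M \<in> supermatrices" "M' \<in> supermatrices"
  shows "M ** M' \<in> supermatrices"
  unfolding supermatrices_iff
proof (intro allI)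
  fix i j
  have "M $ i $ k * M' $ k $ j \<in> grassmann (odd_index i \<noteq> odd_index j)" for k
  proof -
    have "M $ i $ k \<in> grassmann (odd_index i \<noteq> odd_index k)"
      "M' $ k $ j \<in> grassmann (odd_index k \<noteq> odd_index j)"
      using assms unfolding supermatrices_iff by blast+
    from grassmann_mult[OF this] show ?thesis
      by (cases "isl i"; cases "isl j"; cases "isl k"; simp)
  qed
  then show "(M ** M') $ i $ j \<in> grassmann (odd_index i \<noteq> odd_index j)"
    by (simp only: matrix_matrix_mult_def vec_lambda_beta subspace_sum[OF subspace_grassmann])
qed

text \<open>
  The matrix commutator represents the iterated commutators \<open>[X, [Y, \<^bold>x]] - [Y, [X, \<^bold>x]]\<close>, which equal
  \<open>[[X, Y], \<^bold>x]\<close> by the Jacobi identity; representing matrices are unique.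
\<close>

lemma phi_commutator:
  fixes X Y :: "('s, 'm::{finite,linorder}, 'n::{finite,linorder}, 'l::{finite,linorder}) superalg"
  assumes X: "X \<in> ext_superbivectors" and Y: "Y \<in> ext_superbivectors"
  shows "phi (commutator X Y) = matrix_commutator (phi X) (phi Y)"
proof (rule phi_eq)
  have M: "phi X \<in> supermatrices" "phi Y \<in> supermatrices"
    using represents_ad_phi X Y unfolding represents_ad_def by blast+
  have ad: "supervector_of (phi B *v (phi B' *v coordinates s)) = commutator B (commutator B' (supervector s))"
    if B: "B \<in> ext_superbivectors" and B': "B' \<in> ext_superbivectors"
    for B B' :: "('s, 'm, 'n, 'l) superalg" and s
  proof -
    obtain C where C: "C \<in> super_skew" "B = superbivector C"
      using B unfolding ext_superbivectors_eq by blast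
    have rep: "phi B' \<in> supermatrices"
      "supervector_of (phi B' *v coordinates s) = commutator B' (supervector s)"
      using represents_ad_phi[OF B'] unfolding represents_ad_def by blast+
    show ?thesis
      using commutator_superbivector[OF C(1) matrix_coordinates_parity[OF rep(1), where s = s]]
      by (simp add: C phi_superbivector rep(2))
  qed
  show "represents_ad (matrix_commutator (phi X) (phi Y)) (commutator X Y)"
    unfolding represents_ad_def
  proof (intro conjI allI)
    show "matrix_commutator (phi X) (phi Y) \<in> supermatrices"
      unfolding matrix_commutator_def
      by (intro subspace_diff subspace_supermatrices supermatrices_mult M)
    fix s
    show "supervector_of (matrix_commutator (phi X) (phi Y) *v coordinates s) =
        commutator (commutator X Y) (supervector s)"
      by (simp add: matrix_commutator_def matrix_vector_mult_diff_rdistrib supervector_of_diff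
          ad X Y flip: matrix_vector_mul_assoc) (simp add: commutator_def algebra_simps)
  qed
qed

lemma lie_algebra_ext_superbivectors:
  "lie_algebra (ext_superbivectors :: ('s, 'm::{finite,linorder}, 'n::{finite,linorder},
     'l::{finite,linorder}) superalg set) commutator"
  unfolding lie_algebra_def
  by (simp add: subspace_ext_superbivectors commutator_ext_superbivectors)
    (simp add: commutator_def algebra_simps)

lemma matrix_mult_scaleR_right:
  fixes A :: "('a::real_algebra_1)^'m^'n"
  shows "A ** (r *\<^sub>R B) = r *\<^sub>R (A ** B)"
  by (simp add: matrix_matrix_mult_def vec_eq_iff scaleR_sum_right)

lemma matrix_mult_diff_left:
  fixes A B :: "('a::ring_1)^'m^'n"
  shows "(A - B) ** C = A ** C - B ** C"
  by (simp add: matrix_matrix_mult_def vec_eq_iff ring_distribs sum_subtractf)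

lemma matrix_mult_diff_right:
  fixes A :: "('a::ring_1)^'m^'n"
  shows "A ** (B - C) = A ** B - A ** C"
  by (simp add: matrix_matrix_mult_def vec_eq_iff ring_distribs sum_subtractf)

lemma matrix_mult_add_left:
  fixes A B :: "('a::ring_1)^'m^'n"
  shows "(A + B) ** C = A ** C + B ** C"
  by (simp add: matrix_matrix_mult_def vec_eq_iff ring_distribs sum.distrib)

text \<open>
  Closure under the commutator is inherited from the superbivectors through the bijection \<open>phi\<close>,
  which avoids computing with supertransposes of products.
\<close>

lemma lie_algebra_so0:
  "lie_algebra (so0 :: ('s, 'm::{finite,linorder}, 'n::{finite,linorder}, 'l::{finite,linorder}) smat set)
     matrix_commutator"
proof -
  have "subspace (so0 :: ('s, 'm, 'n, 'l) smat set)"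
    unfolding so0_eq by (rule linear_subspace_image[OF linear_ad_matrix subspace_super_skew])
  moreover have "matrix_commutator M M' \<in> so0" if mem: "M \<in> so0" "M' \<in> so0"
    for M M' :: "('s, 'm, 'n, 'l) smat"
  proof -
    have surj: "phi ` ext_superbivectors = (so0 :: ('s, 'm, 'n, 'l) smat set)"
      by (rule bij_betw_imp_surj_on[OF bij_betw_phi])
    obtain X Y :: "('s, 'm, 'n, 'l) superalg" where XY: "X \<in> ext_superbivectors" "Y \<in> ext_superbivectors"
      and M: "M = phi X" "M' = phi Y"
      using mem unfolding surj[symmetric] by blast
    have "phi (commutator X Y) \<in> (so0 :: ('s, 'm, 'n, 'l) smat set)"
      unfolding surj[symmetric] by (rule imageI[OF commutator_ext_superbivectors[OF XY]])
    then show ?thesis by (simp add: M phi_commutator[OF XY])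
  qed
  ultimately show ?thesis
    unfolding lie_algebra_def
    by (simp add: matrix_commutator_def matrix_mult_diff_left matrix_mult_diff_right
        matrix_mult_add_left matrix_add_ldistrib matrix_mult_scaleR_right matrix_mul_assoc
        scaleR_diff_right flip: scalar_matrix_assoc)
qed

theorem theorem4:
  assumes "CARD('s::finite) > 1"
  shows "(\<forall>B \<in> (ext_superbivectors ::
            ('s, 'm::{finite,linorder}, 'n::{finite,linorder}, 'l::{finite,linorder}) superalg set).
            \<exists>!M. represents_ad M B) \<and>
         lie_algebra_iso ext_superbivectors commutator so0 matrix_commutator
           (phi :: ('s, 'm, 'n, 'l) superalg \<Rightarrow> ('s, 'm, 'n, 'l) smat)"
  unfolding lie_algebra_iso_def
  using represents_ad_phi represents_ad_unique lie_algebra_ext_superbivectors lie_algebra_so0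
    bij_betw_phi phi_linear phi_commutator
  by blast

end
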